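(* Let $\mathfrak g$ be a Lie algebra, $\mathfrak l\subset\mathfrak g$ a Lie subalgebra with inclusion $i$, $L$ the connected Lie subgroup with Lie algebra $\mathfrak l$, $U\subset\mathfrak l^*$ an $\mathrm{Ad}^*_L$-invariant open subset, $l:U\to\mathcal A(\mathfrak g^*,\mathfrak g)$ a smooth map, $\varpi:\mathfrak g\to\mathcal A(\mathfrak g^*,\mathfrak g)$ a Lie algebra $1$-cocycle and $\varphi\in\wedge^3\mathfrak g$. Assume that for all $p\in U$, $x\in\mathfrak g$, $z\in\mathfrak l$ and $\xi,\eta,\zeta\in\mathfrak g^*$: $$\langle\xi\otimes\eta\otimes\zeta,\mathrm{ad}_x^{(3)}\varphi\rangle=\sum_{\mathrm{cyc}(\xi,\eta,\zeta)}\langle\xi,\varpi_{\varpi_x\eta}\zeta\rangle,$$ $$\sum_{\mathrm{cyc}(\xi,\eta,\zeta)}\big(\langle\zeta,d_pl(i^*\xi)\eta\rangle-\langle\zeta,[l_p\xi,l_p\eta]\rangle-\langle\zeta,\varpi_{l_p\xi}\eta\rangle\big)=\langle\xi\otimes\eta\otimes\zeta,\varphi\rangle,$$ $$d_pl(\mathrm{ad}^*_zp)+\varpi_{iz}+\mathrm{ad}_{iz}l_p+l_p\mathrm{ad}^*_{iz}=0.$$ Let $q_0\in U$. Then the quadruple $\mathcal G^{q_0}=(\mathfrak g,[\,,\,],\varpi^{l_{q_0}},\varphi^{l_{q_0}})$ is a Lie quasi-bialgebra. Moreover, the Lie algebra $$\mathfrak g^\star_{q_0}=\{i(z)+\xi\in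 i(\mathfrak l)\oplus\mathfrak g^*:\ i^*\xi=\mathrm{ad}^*_zq_0\}\subset\mathfrak g\oplus\mathfrak g^*,$$ with the bracket $[\,,\,]^\star_{q_0}$ given in the context, is a Lagrangian subalgebra of the canonical double $\mathfrak d^{q_0}$ of $\mathcal G^{q_0}$.
   Context: Conventions: vector spaces are finite-dimensional over $\mathbb K=\mathbb R$ or $\mathbb C$; $f^*$ is the transpose of $f$; $\mathcal A(\mathfrak g^*,\mathfrak g)$ is the set of linear maps $t:\mathfrak g^*\to\mathfrak g$ with $t^*=-t$; $\mathrm{ad}^*_x$ is the transpose of $\mathrm{ad}_x$, i.e. $\langle\mathrm{ad}^*_x\xi,y\rangle=\langle\xi,[x,y]\rangle$; $\mathrm{ad}^{(3)}_x$ is the action of $x$ on $\mathfrak g^{\otimes3}$; $\sum_{\mathrm{cyc}}$ is the sum over cyclic permutations. A $1$-cocycle $\varpi:\mathfrak g\to\mathcal A(\mathfrak g^*,\mathfrak g)$ is a linear map with $\varpi_{[x,y]}=\mathrm{ad}_x\varpi_y+\varpi_y\mathrm{ad}^*_x-\mathrm{ad}_y\varpi_x-\varpi_x\mathrm{ad}^*_y$. Lie quasi-bialgebra: a quadruple $(\mathfrak g,[\,,\,],\varpi,\varphi)$, $\varpi$ a $1$-cocycle, $\varphi\in\wedge^3\mathfrak g$, such that $\mathfrak d=\mathfrak g\oplus\mathfrak g^*$ with bracket $[x,y]_{\mathfrak d}=[x,y]$, $[x,\xi]_{\mathfrak d}=\varpi_x\xi-\mathrm{ad}^*_x\xi$,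 $[\xi,\eta]_{\mathfrak d}=\langle\eta,\varpi_\bullet\xi\rangle+\langle\xi\otimes\eta\otimes1,\varphi\rangle$ is a Lie algebra (its canonical double). Here $\langle\eta,\varpi_\bullet\xi\rangle\in\mathfrak g^*$ is $x\mapsto\langle\eta,\varpi_x\xi\rangle$, and $\langle\xi\otimes\eta\otimes1,\varphi\rangle\in\mathfrak g$ is the contraction on the first two slots. The double carries the form $(x+\xi,y+\eta)_{\mathfrak d}=\langle\xi,y\rangle+\langle\eta,x\rangle$; Lagrangian means maximal isotropic for this form. For $t\in\mathcal A(\mathfrak g^*,\mathfrak g)$: $\varpi^t_x=\varpi_x+\mathrm{ad}_xt+t\,\mathrm{ad}^*_x$ and $\langle\xi\otimes\eta\otimes\zeta,\varphi^t\rangle=\langle\xi\otimes\eta\otimes\zeta,\varphi\rangle+\sum_{\mathrm{cyc}(\xi,\eta,\zeta)}\langle\zeta,[t\xi,t\eta]+\varpi_{t\xi}\eta\rangle$. The bracket on $\mathfrak g^\star_{q_0}$: for $i(z)+\xi,\ i(z')+\xi'\in\mathfrak g^\star_{q_0}$, writing $l=l_{q_0}$, the $\mathfrak g$-component of $[i(z)+\xi,i(z')+\xi']^\star_{q_0}$ is $$i([z,z'])+\varpi_{i(z)}\xi'+\mathrm{ad}_{i(z)}l\xi'+l\,\mathrm{ad}^*_{i(z)}\xi'-\varpi_{i(z')}\xi-\mathrm{ad}_{i(z')}l\xi-l\,\mathrm{ad}^*_{i(z')}\xi+[l\xi,l\xi']+l\,\mathrm{ad}^*_{l\xi}\xi'-l\,\mathrm{ad}^*_{l\xi'}\xi+\varpi_{l\xi}\xi'-\varpi_{l\xi'}\xi-\langle\xi,\varpi_{l\bullet}\xi'\rangle+\langle\xi\otimes\xi'\otimes1,\varphi\rangle$$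 and its $\mathfrak g^*$-component is $$-\mathrm{ad}^*_{i(z)}\xi'+\mathrm{ad}^*_{i(z')}\xi-\langle\xi,\varpi_\bullet\xi'\rangle-\mathrm{ad}^*_{l\xi}\xi'+\mathrm{ad}^*_{l\xi'}\xi .$$ *)

theory Defs
  imports "HOL-Analysis.Analysis" "HOL-Library.Function_Algebras" "HOL-Algebra.Group"
begin

text \<open>
  The ground field is a type of sort \<open>{real_normed_field, euclidean_space}\<close>. By the theorem of
  Frobenius (or Gelfand-Mazur) such a type is isomorphic, with its norm, to the real or to the
  complex numbers, and both are instances. A vector space is a subset \<open>V\<close> of a type together with
  a scalar multiplication \<open>s\<close>; the dimension may be zero.
\<close>

section \<open>Finite-dimensional vector spaces and their duals\<close>

definition fd_space :: "('k::{real_normed_field,euclidean_space} \<Rightarrow> 'v::ab_group_add \<Rightarrow> 'v) \<Rightarrow> 'v set \<Rightarrow> bool"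
  where "fd_space s V \<longleftrightarrow>
    vector_space s \<and> module.subspace s V \<and> (\<exists>B. finite B \<and> module.span s B = V)"

definition linear_map :: "('k::{real_normed_field,euclidean_space} \<Rightarrow> 'v::ab_group_add \<Rightarrow> 'v) \<Rightarrow> 'v set \<Rightarrow>
    ('k \<Rightarrow> 'w::ab_group_add \<Rightarrow> 'w) \<Rightarrow> 'w set \<Rightarrow> ('v \<Rightarrow> 'w) \<Rightarrow> bool"
  where "linear_map s V s' W f \<longleftrightarrow> f ` V \<subseteq> W \<and>
    (\<forall>x\<in>V. \<forall>y\<in>V. f (x + y) = f x + f y) \<and> (\<forall>c. \<forall>x\<in>V. f (s c x) = s' c (f x))"

text \<open>Functionals on \<open>V\<close> are extended by zero, so that equality of functionals on \<open>V\<close> is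
  equality of functions.\<close>

definition dual :: "('k::{real_normed_field,euclidean_space} \<Rightarrow> 'v::ab_group_add \<Rightarrow> 'v) \<Rightarrow> 'v set \<Rightarrow> ('v \<Rightarrow> 'k) set"
  where "dual s V = {f. linear_map s V (*) UNIV f \<and> (\<forall>x. x \<notin> V \<longrightarrow> f x = 0)}"

definition dscale :: "'k::{real_normed_field,euclidean_space} \<Rightarrow> ('v \<Rightarrow> 'k) \<Rightarrow> ('v \<Rightarrow> 'k)"
  where "dscale c f = (\<lambda>x. c * f x)"

definition pscale :: "('k \<Rightarrow> 'v \<Rightarrow> 'v) \<Rightarrow> ('k \<Rightarrow> 'w \<Rightarrow> 'w) \<Rightarrow> 'k \<Rightarrow> 'v \<times> 'w \<Rightarrow> 'v \<times> 'w"
  where "pscale s s' c = map_prod (s c) (s' c)"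

text \<open>The transpose of the inclusion of \<open>V\<close>.\<close>

definition restr :: "'v set \<Rightarrow> ('v \<Rightarrow> 'k::{real_normed_field,euclidean_space}) \<Rightarrow> ('v \<Rightarrow> 'k)"
  where "restr V f = (\<lambda>x. if x \<in> V then f x else 0)"

text \<open>The vector corresponding to a functional on the dual, under the identification of a
  finite-dimensional space with its bidual.\<close>

definition vec_of :: "('k::{real_normed_field,euclidean_space} \<Rightarrow> 'v::ab_group_add \<Rightarrow> 'v) \<Rightarrow> (('v \<Rightarrow> 'k) \<Rightarrow> 'k) \<Rightarrow> 'v"
  where "vec_of s F = (THE u. \<forall>\<zeta>\<in>dual s UNIV. \<zeta> u = F \<zeta>)"

section \<open>Topology and smooth maps\<close>

text \<open>The topology making all functionals continuous; in finite dimension this is the usual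
  vector space topology.\<close>

definition fd_top :: "('k::{real_normed_field,euclidean_space} \<Rightarrow> 'v::ab_group_add \<Rightarrow> 'v) \<Rightarrow> 'v set \<Rightarrow> 'v topology"
  where "fd_top s V = topology_generated_by {{x\<in>V. f x \<in> S} | f S. f \<in> dual s V \<and> open S}"

text \<open>A scalar function is \<open>C\<^sup>k\<close> when its iterated directional derivatives up to order \<open>k\<close> exist and
  those of order \<open>k\<close> are continuous. The derivatives are taken with respect to a parameter in
  the ground field, so that over the complex numbers smooth means holomorphic.\<close>

primrec Ck_on :: "nat \<Rightarrow> ('k::{real_normed_field,euclidean_space} \<Rightarrow> 'v::ab_group_add \<Rightarrow> 'v) \<Rightarrow> 'v set \<Rightarrow> 'v set \<Rightarrow>
    ('v \<Rightarrow> 'k) \<Rightarrow> bool"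
  where
    "Ck_on 0 s V U F \<longleftrightarrow> continuous_map (subtopology (fd_top s V) U) euclidean F"
  | "Ck_on (Suc k) s V U F \<longleftrightarrow> (\<exists>F'. \<forall>v\<in>V.
       (\<forall>p\<in>U. ((\<lambda>t. F (p + s t v)) has_field_derivative F' v p) (at 0)) \<and> Ck_on k s V U (F' v))"

definition smooth_map :: "('k::{real_normed_field,euclidean_space} \<Rightarrow> 'v::ab_group_add \<Rightarrow> 'v) \<Rightarrow> 'v set \<Rightarrow>
    ('k \<Rightarrow> 'w::ab_group_add \<Rightarrow> 'w) \<Rightarrow> 'w set \<Rightarrow> 'v set \<Rightarrow> ('v \<Rightarrow> 'w) \<Rightarrow> bool"
  where "smooth_map s V s' W U F \<longleftrightarrow>
    F ` U \<subseteq> W \<and> (\<forall>f\<in>dual s' W. \<forall>k. Ck_on k s V U (\<lambda>p. f (F p)))"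

text \<open>\<open>w\<close> is the value at \<open>v\<close> of the differential of \<open>F\<close> at \<open>p\<close>, where \<open>F\<close> takes values in \<open>W\<close>.\<close>

definition has_dderiv :: "('k::{real_normed_field,euclidean_space} \<Rightarrow> 'v::ab_group_add \<Rightarrow> 'v) \<Rightarrow>
    ('k \<Rightarrow> 'w::ab_group_add \<Rightarrow> 'w) \<Rightarrow> 'w set \<Rightarrow> ('v \<Rightarrow> 'w) \<Rightarrow> 'v \<Rightarrow> 'v \<Rightarrow> 'w \<Rightarrow> bool"
  where "has_dderiv s s' W F p v w \<longleftrightarrow> w \<in> W \<and>
    (\<forall>f\<in>dual s' W. ((\<lambda>t. f (F (p + s t v))) has_field_derivative f w) (at 0))"

definition dderiv :: "('k::{real_normed_field,euclidean_space} \<Rightarrow> 'v::ab_group_add \<Rightarrow> 'v) \<Rightarrow>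
    ('k \<Rightarrow> 'w::ab_group_add \<Rightarrow> 'w) \<Rightarrow> 'w set \<Rightarrow> ('v \<Rightarrow> 'w) \<Rightarrow> 'v \<Rightarrow> 'v \<Rightarrow> 'w"
  where "dderiv s s' W F p v = (THE w. has_dderiv s s' W F p v w)"

section \<open>Lie groups\<close>

text \<open>An atlas modelled on \<open>(s, V)\<close> is a set of charts \<open>(D, \<kappa>)\<close> with domain \<open>D\<close>.\<close>

definition smooth_between :: "('k::{real_normed_field,euclidean_space} \<Rightarrow> 'v::ab_group_add \<Rightarrow> 'v) \<Rightarrow> 'v set \<Rightarrow>
    'a topology \<Rightarrow> ('a set \<times> ('a \<Rightarrow> 'v)) set \<Rightarrow>
    ('k \<Rightarrow> 'w::ab_group_add \<Rightarrow> 'w) \<Rightarrow> 'w set \<Rightarrow> 'b topology \<Rightarrow> ('b set \<times> ('b \<Rightarrow> 'w)) set \<Rightarrow>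
    ('a \<Rightarrow> 'b) \<Rightarrow> bool"
  where "smooth_between s V T A s' W T' A' F \<longleftrightarrow> continuous_map T T' F \<and>
    (\<forall>(D, \<kappa>)\<in>A. \<forall>(D', \<kappa>')\<in>A'.
       smooth_map s V s' W (\<kappa> ` {a\<in>D. F a \<in> D'}) (\<lambda>u. \<kappa>' (F (inv_into D \<kappa> u))))"

text \<open>Smoothness of the identity expresses the smooth compatibility of the charts.\<close>

definition smooth_manifold :: "('k::{real_normed_field,euclidean_space} \<Rightarrow> 'v::ab_group_add \<Rightarrow> 'v) \<Rightarrow> 'v set \<Rightarrow>
    'a topology \<Rightarrow> ('a set \<times> ('a \<Rightarrow> 'v)) set \<Rightarrow> bool"
  where "smooth_manifold s V T A \<longleftrightarrow> fd_space s V \<and> Hausdorff_space T \<and> second_countable T \<and>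
    (\<Union>(D, \<kappa>)\<in>A. D) = topspace T \<and>
    (\<forall>(D, \<kappa>)\<in>A. openin T D \<and> openin (fd_top s V) (\<kappa> ` D) \<and>
       homeomorphic_map (subtopology T D) (subtopology (fd_top s V) (\<kappa> ` D)) \<kappa>) \<and>
    smooth_between s V T A s V T A id"

definition prod_atlas :: "('a set \<times> ('a \<Rightarrow> 'v)) set \<Rightarrow> (('a \<times> 'a) set \<times> ('a \<times> 'a \<Rightarrow> 'v \<times> 'v)) set"
  where "prod_atlas A = {(D \<times> D', map_prod \<kappa> \<kappa>') | D \<kappa> D' \<kappa>'. (D, \<kappa>) \<in> A \<and> (D', \<kappa>') \<in> A}"

definition lie_group :: "('k::{real_normed_field,euclidean_space} \<Rightarrow> 'v::ab_group_add \<Rightarrow> 'v) \<Rightarrow> 'v set \<Rightarrow>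
    'a monoid \<Rightarrow> 'a topology \<Rightarrow> ('a set \<times> ('a \<Rightarrow> 'v)) set \<Rightarrow> bool"
  where "lie_group s V G T A \<longleftrightarrow> group G \<and> topspace T = carrier G \<and> smooth_manifold s V T A \<and>
    smooth_between (pscale s s) (V \<times> V) (prod_topology T T) (prod_atlas A) s V T A
      (\<lambda>(g, h). g \<otimes>\<^bsub>G\<^esub> h) \<and>
    smooth_between s V T A s V T A (m_inv G)"

text \<open>The adjoint action on the tangent space at the unit, read in a chart \<open>(D, \<kappa>)\<close> around the
  unit: the differential at the unit of conjugation by \<open>g\<close>.\<close>

definition Ad :: "('k::{real_normed_field,euclidean_space} \<Rightarrow> 'v::ab_group_add \<Rightarrow> 'v) \<Rightarrow> 'v set \<Rightarrow>
    'a monoid \<Rightarrow> 'a set \<times> ('a \<Rightarrow> 'v) \<Rightarrow> 'a \<Rightarrow> 'v \<Rightarrow> 'v"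
  where "Ad s V G = (\<lambda>(D, \<kappa>) g v.
    dderiv s s V (\<lambda>u. \<kappa> (g \<otimes>\<^bsub>G\<^esub> inv_into D \<kappa> u \<otimes>\<^bsub>G\<^esub> m_inv G g)) (\<kappa> \<one>\<^bsub>G\<^esub>) v)"

text \<open>The chart \<open>(D, \<kappa>)\<close> identifies the tangent space at the unit with \<open>V\<close>; under this
  identification the Lie bracket, i.e. the differential at the unit of \<open>g \<mapsto> Ad\<^sub>g y\<close>
  in the direction \<open>x\<close>, is \<open>br x y\<close>.\<close>

definition lie_group_with_algebra :: "('k::{real_normed_field,euclidean_space} \<Rightarrow> 'v::ab_group_add \<Rightarrow> 'v) \<Rightarrow> 'v set \<Rightarrow>
    ('v \<Rightarrow> 'v \<Rightarrow> 'v) \<Rightarrow> 'a monoid \<Rightarrow> 'a topology \<Rightarrow> ('a set \<times> ('a \<Rightarrow> 'v)) set \<Rightarrow>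
    'a set \<times> ('a \<Rightarrow> 'v) \<Rightarrow> bool"
  where "lie_group_with_algebra s V br G T A = (\<lambda>(D, \<kappa>).
    lie_group s V G T A \<and> (D, \<kappa>) \<in> A \<and> \<one>\<^bsub>G\<^esub> \<in> D \<and>
    (\<forall>x\<in>V. \<forall>y\<in>V.
       has_dderiv s s V (\<lambda>u. Ad s V G (D, \<kappa>) (inv_into D \<kappa> u) y) (\<kappa> \<one>\<^bsub>G\<^esub>) x (br x y)))"

text \<open>\<open>H\<close>, with its own topology \<open>T'\<close> and atlas \<open>A'\<close>, is a connected (immersed) Lie subgroup of
  the Lie group \<open>G\<close>, and the Lie algebra of \<open>H\<close> is the subspace \<open>W\<close> of the Lie algebra \<open>V\<close> of
  \<open>G\<close>: the differential at the unit of the inclusion of \<open>H\<close> is the inclusion of \<open>W\<close>.\<close>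

definition connected_lie_subgroup :: "('k::{real_normed_field,euclidean_space} \<Rightarrow> 'v::ab_group_add \<Rightarrow> 'v) \<Rightarrow>
    ('v \<Rightarrow> 'v \<Rightarrow> 'v) \<Rightarrow> 'v set \<Rightarrow> 'a monoid \<Rightarrow> 'a topology \<Rightarrow> ('a set \<times> ('a \<Rightarrow> 'v)) set \<Rightarrow>
    'a set \<times> ('a \<Rightarrow> 'v) \<Rightarrow>
    'v set \<Rightarrow> 'a set \<Rightarrow> 'a topology \<Rightarrow> ('a set \<times> ('a \<Rightarrow> 'v)) set \<Rightarrow> 'a set \<times> ('a \<Rightarrow> 'v) \<Rightarrow> bool"
  where "connected_lie_subgroup s br V G T A c W H T' A' c' \<longleftrightarrow>
    lie_group_with_algebra s V br G T A c \<and> subgroup H G \<and>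
    lie_group_with_algebra s W br (G\<lparr>carrier := H\<rparr>) T' A' c' \<and> connected_space T' \<and>
    smooth_between s W T' A' s V T A id \<and>
    (\<forall>v\<in>W. has_dderiv s s V (\<lambda>u. snd c (inv_into (fst c') (snd c') u)) (snd c' \<one>\<^bsub>G\<^esub>) v v)"

text \<open>The transpose of \<open>Ad\<^sub>g\<close> is used without inverting \<open>g\<close>, which does not affect invariance under
  the whole group.\<close>

definition coAd_invariant :: "('k::{real_normed_field,euclidean_space} \<Rightarrow> 'v::ab_group_add \<Rightarrow> 'v) \<Rightarrow> 'v set \<Rightarrow>
    'a monoid \<Rightarrow> 'a set \<times> ('a \<Rightarrow> 'v) \<Rightarrow> ('v \<Rightarrow> 'k) set \<Rightarrow> bool"
  where "coAd_invariant s V G c U \<longleftrightarrow>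
    (\<forall>g\<in>carrier G. \<forall>p\<in>U. restr V (\<lambda>v. p (Ad s V G c g v)) \<in> U)"

section \<open>Lie algebras and Lie quasi-bialgebras\<close>

definition lie_algebra :: "('k::{real_normed_field,euclidean_space} \<Rightarrow> 'v::ab_group_add \<Rightarrow> 'v) \<Rightarrow> 'v set \<Rightarrow>
    ('v \<Rightarrow> 'v \<Rightarrow> 'v) \<Rightarrow> bool"
  where "lie_algebra s V br \<longleftrightarrow> fd_space s V \<and>
    (\<forall>x\<in>V. linear_map s V s V (br x)) \<and> (\<forall>y\<in>V. linear_map s V s V (\<lambda>x. br x y)) \<and>
    (\<forall>x\<in>V. br x x = 0) \<and>
    (\<forall>x\<in>V. \<forall>y\<in>V. \<forall>z\<in>V. br x (br y z) + br y (br z x) + br z (br x y) = 0)"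

definition lie_subalgebra :: "('k::{real_normed_field,euclidean_space} \<Rightarrow> 'v::ab_group_add \<Rightarrow> 'v) \<Rightarrow> 'v set \<Rightarrow>
    ('v \<Rightarrow> 'v \<Rightarrow> 'v) \<Rightarrow> 'v set \<Rightarrow> bool"
  where "lie_subalgebra s V br W \<longleftrightarrow> module.subspace s W \<and> W \<subseteq> V \<and> (\<forall>x\<in>W. \<forall>y\<in>W. br x y \<in> W)"

text \<open>\<open>ad\<^sup>*\<^sub>x\<close> for \<open>x \<in> V\<close>: the transpose of \<open>ad\<^sub>x\<close>, without a sign.\<close>

definition coad :: "('v \<Rightarrow> 'v \<Rightarrow> 'v) \<Rightarrow> 'v set \<Rightarrow> 'v \<Rightarrow> ('v \<Rightarrow> 'k::{real_normed_field,euclidean_space}) \<Rightarrow> ('v \<Rightarrow> 'k)"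
  where "coad br V x f = restr V (\<lambda>y. f (br x y))"

text \<open>From here on the Lie algebra is the whole type \<open>'g\<close>. Maps on its dual are represented by
  functions on \<open>'g \<Rightarrow> 'k\<close> whose values outside the dual are irrelevant; accordingly smoothness
  and the differential of a family \<open>l\<close> of such maps are those of \<open>p \<mapsto> l p \<eta>\<close> for \<open>\<eta>\<close> in the
  dual.\<close>

definition antisym_maps :: "('k::{real_normed_field,euclidean_space} \<Rightarrow> 'g::ab_group_add \<Rightarrow> 'g) \<Rightarrow> (('g \<Rightarrow> 'k) \<Rightarrow> 'g) set"
  where "antisym_maps s = {t. linear_map dscale (dual s UNIV) s UNIV t \<and>
    (\<forall>\<xi>\<in>dual s UNIV. \<forall>\<eta>\<in>dual s UNIV. \<eta> (t \<xi>) = - \<xi> (t \<eta>))}"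

definition cocycle :: "('k::{real_normed_field,euclidean_space} \<Rightarrow> 'g::ab_group_add \<Rightarrow> 'g) \<Rightarrow> ('g \<Rightarrow> 'g \<Rightarrow> 'g) \<Rightarrow>
    ('g \<Rightarrow> ('g \<Rightarrow> 'k) \<Rightarrow> 'g) \<Rightarrow> bool"
  where "cocycle s br \<omega> \<longleftrightarrow> (\<forall>x. \<omega> x \<in> antisym_maps s) \<and>
    (\<forall>\<xi>\<in>dual s UNIV. linear_map s UNIV s UNIV (\<lambda>x. \<omega> x \<xi>)) \<and>
    (\<forall>x y. \<forall>\<xi>\<in>dual s UNIV. \<omega> (br x y) \<xi> =
       br x (\<omega> y \<xi>) + \<omega> y (coad br UNIV x \<xi>) - br y (\<omega> x \<xi>) - \<omega> x (coad br UNIV y \<xi>))"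

text \<open>An element of the third tensor power of the (finite-dimensional) Lie algebra is represented
  by the trilinear form \<open>\<langle>\<xi> \<otimes> \<eta> \<otimes> \<zeta>, \<phi>\<rangle>\<close> on its dual.\<close>

definition wedge3 :: "('k::{real_normed_field,euclidean_space} \<Rightarrow> 'g::ab_group_add \<Rightarrow> 'g) \<Rightarrow>
    (('g \<Rightarrow> 'k) \<Rightarrow> ('g \<Rightarrow> 'k) \<Rightarrow> ('g \<Rightarrow> 'k) \<Rightarrow> 'k) set"
  where "wedge3 s = {\<phi>. \<forall>\<xi>\<in>dual s UNIV. \<forall>\<eta>\<in>dual s UNIV.
    linear_map dscale (dual s UNIV) (*) UNIV (\<lambda>\<zeta>. \<phi> \<zeta> \<xi> \<eta>) \<and>
    linear_map dscale (dual s UNIV) (*) UNIV (\<lambda>\<zeta>. \<phi> \<xi> \<zeta> \<eta>) \<and>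
    linear_map dscale (dual s UNIV) (*) UNIV (\<lambda>\<zeta>. \<phi> \<xi> \<eta> \<zeta>) \<and>
    \<phi> \<xi> \<xi> \<eta> = 0 \<and> \<phi> \<xi> \<eta> \<xi> = 0 \<and> \<phi> \<eta> \<xi> \<xi> = 0}"

definition ad3 :: "('g \<Rightarrow> 'g \<Rightarrow> 'g) \<Rightarrow> 'g \<Rightarrow>
    (('g \<Rightarrow> 'k::{real_normed_field,euclidean_space}) \<Rightarrow> ('g \<Rightarrow> 'k) \<Rightarrow> ('g \<Rightarrow> 'k) \<Rightarrow> 'k) \<Rightarrow>
    ('g \<Rightarrow> 'k) \<Rightarrow> ('g \<Rightarrow> 'k) \<Rightarrow> ('g \<Rightarrow> 'k) \<Rightarrow> 'k"
  where "ad3 br x \<phi> \<xi> \<eta> \<zeta> =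
    \<phi> (coad br UNIV x \<xi>) \<eta> \<zeta> + \<phi> \<xi> (coad br UNIV x \<eta>) \<zeta> + \<phi> \<xi> \<eta> (coad br UNIV x \<zeta>)"

definition cyc :: "('a \<Rightarrow> 'a \<Rightarrow> 'a \<Rightarrow> 'k::ab_group_add) \<Rightarrow> 'a \<Rightarrow> 'a \<Rightarrow> 'a \<Rightarrow> 'k"
  where "cyc F \<xi> \<eta> \<zeta> = F \<xi> \<eta> \<zeta> + F \<eta> \<zeta> \<xi> + F \<zeta> \<xi> \<eta>"

abbreviation double_carrier :: "('k::{real_normed_field,euclidean_space} \<Rightarrow> 'g::ab_group_add \<Rightarrow> 'g) \<Rightarrow> ('g \<times> ('g \<Rightarrow> 'k)) set"
  where "double_carrier s \<equiv> UNIV \<times> dual s UNIV"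

definition double_bracket :: "('k::{real_normed_field,euclidean_space} \<Rightarrow> 'g::ab_group_add \<Rightarrow> 'g) \<Rightarrow> ('g \<Rightarrow> 'g \<Rightarrow> 'g) \<Rightarrow>
    ('g \<Rightarrow> ('g \<Rightarrow> 'k) \<Rightarrow> 'g) \<Rightarrow> (('g \<Rightarrow> 'k) \<Rightarrow> ('g \<Rightarrow> 'k) \<Rightarrow> ('g \<Rightarrow> 'k) \<Rightarrow> 'k) \<Rightarrow>
    'g \<times> ('g \<Rightarrow> 'k) \<Rightarrow> 'g \<times> ('g \<Rightarrow> 'k) \<Rightarrow> 'g \<times> ('g \<Rightarrow> 'k)"
  where "double_bracket s br \<omega> \<phi> = (\<lambda>(x, \<xi>) (y, \<eta>).
    (br x y + \<omega> x \<eta> - \<omega> y \<xi> + vec_of s (\<phi> \<xi> \<eta>),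
     - coad br UNIV x \<eta> + coad br UNIV y \<xi> + (\<lambda>v. \<eta> (\<omega> v \<xi>))))"

definition lie_quasi_bialgebra :: "('k::{real_normed_field,euclidean_space} \<Rightarrow> 'g::ab_group_add \<Rightarrow> 'g) \<Rightarrow>
    ('g \<Rightarrow> 'g \<Rightarrow> 'g) \<Rightarrow> ('g \<Rightarrow> ('g \<Rightarrow> 'k) \<Rightarrow> 'g) \<Rightarrow>
    (('g \<Rightarrow> 'k) \<Rightarrow> ('g \<Rightarrow> 'k) \<Rightarrow> ('g \<Rightarrow> 'k) \<Rightarrow> 'k) \<Rightarrow> bool"
  where "lie_quasi_bialgebra s br \<omega> \<phi> \<longleftrightarrow>
    lie_algebra s UNIV br \<and> cocycle s br \<omega> \<and> \<phi> \<in> wedge3 s \<and>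
    lie_algebra (pscale s dscale) (double_carrier s) (double_bracket s br \<omega> \<phi>)"

definition double_form :: "'g \<times> ('g \<Rightarrow> 'k::{real_normed_field,euclidean_space}) \<Rightarrow> 'g \<times> ('g \<Rightarrow> 'k) \<Rightarrow> 'k"
  where "double_form = (\<lambda>(x, \<xi>) (y, \<eta>). \<xi> y + \<eta> x)"

definition isotropic :: "('k::{real_normed_field,euclidean_space} \<Rightarrow> 'g::ab_group_add \<Rightarrow> 'g) \<Rightarrow> ('g \<times> ('g \<Rightarrow> 'k)) set \<Rightarrow> bool"
  where "isotropic s W \<longleftrightarrow> module.subspace (pscale s dscale) W \<and> W \<subseteq> double_carrier s \<and>
    (\<forall>a\<in>W. \<forall>b\<in>W. double_form a b = 0)"

definition lagrangian :: "('k::{real_normed_field,euclidean_space} \<Rightarrow> 'g::ab_group_add \<Rightarrow> 'g) \<Rightarrow> ('g \<times> ('g \<Rightarrow> 'k)) set \<Rightarrow> bool"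
  where "lagrangian s W \<longleftrightarrow> isotropic s W \<and> (\<forall>W'. isotropic s W' \<and> W \<subseteq> W' \<longrightarrow> W' = W)"

definition twist_cocycle :: "('g::ab_group_add \<Rightarrow> 'g \<Rightarrow> 'g) \<Rightarrow> (('g \<Rightarrow> 'k::{real_normed_field,euclidean_space}) \<Rightarrow> 'g) \<Rightarrow>
    ('g \<Rightarrow> ('g \<Rightarrow> 'k) \<Rightarrow> 'g) \<Rightarrow> 'g \<Rightarrow> ('g \<Rightarrow> 'k) \<Rightarrow> 'g"
  where "twist_cocycle br t \<omega> x \<xi> = \<omega> x \<xi> + br x (t \<xi>) + t (coad br UNIV x \<xi>)"

definition twist_form :: "('g::ab_group_add \<Rightarrow> 'g \<Rightarrow> 'g) \<Rightarrow> (('g \<Rightarrow> 'k::{real_normed_field,euclidean_space}) \<Rightarrow> 'g) \<Rightarrow>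
    ('g \<Rightarrow> ('g \<Rightarrow> 'k) \<Rightarrow> 'g) \<Rightarrow> (('g \<Rightarrow> 'k) \<Rightarrow> ('g \<Rightarrow> 'k) \<Rightarrow> ('g \<Rightarrow> 'k) \<Rightarrow> 'k) \<Rightarrow>
    ('g \<Rightarrow> 'k) \<Rightarrow> ('g \<Rightarrow> 'k) \<Rightarrow> ('g \<Rightarrow> 'k) \<Rightarrow> 'k"
  where "twist_form br t \<omega> \<phi> \<xi> \<eta> \<zeta> =
    \<phi> \<xi> \<eta> \<zeta> + cyc (\<lambda>\<xi> \<eta> \<zeta>. \<zeta> (br (t \<xi>) (t \<eta>) + \<omega> (t \<xi>) \<eta>)) \<xi> \<eta> \<zeta>"

section \<open>The Lie algebra attached to a point\<close>

definition star_carrier :: "('k::{real_normed_field,euclidean_space} \<Rightarrow> 'g::ab_group_add \<Rightarrow> 'g) \<Rightarrow> ('g \<Rightarrow> 'g \<Rightarrow> 'g) \<Rightarrow>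
    'g set \<Rightarrow> ('g \<Rightarrow> 'k) \<Rightarrow> ('g \<times> ('g \<Rightarrow> 'k)) set"
  where "star_carrier s br \<ll> q = {(z, \<xi>). z \<in> \<ll> \<and> \<xi> \<in> dual s UNIV \<and> restr \<ll> \<xi> = coad br \<ll> z q}"

text \<open>In the bracket, \<open>\<langle>\<xi>, \<omega>\<^bsub>l\<bullet>\<^esub> \<xi>'\<rangle>\<close> is the vector on which \<open>\<zeta>\<close> takes the value
  \<open>\<langle>\<xi>, \<omega>\<^bsub>l\<zeta>\<^esub> \<xi>'\<rangle>\<close>.\<close>

definition star_bracket :: "('k::{real_normed_field,euclidean_space} \<Rightarrow> 'g::ab_group_add \<Rightarrow> 'g) \<Rightarrow> ('g \<Rightarrow> 'g \<Rightarrow> 'g) \<Rightarrow>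
    ('g \<Rightarrow> ('g \<Rightarrow> 'k) \<Rightarrow> 'g) \<Rightarrow> (('g \<Rightarrow> 'k) \<Rightarrow> ('g \<Rightarrow> 'k) \<Rightarrow> ('g \<Rightarrow> 'k) \<Rightarrow> 'k) \<Rightarrow> (('g \<Rightarrow> 'k) \<Rightarrow> 'g) \<Rightarrow>
    'g \<times> ('g \<Rightarrow> 'k) \<Rightarrow> 'g \<times> ('g \<Rightarrow> 'k) \<Rightarrow> 'g \<times> ('g \<Rightarrow> 'k)"
  where "star_bracket s br \<omega> \<phi> l = (\<lambda>(z, \<xi>) (z', \<xi>').
    (br z z'
       + \<omega> z \<xi>' + br z (l \<xi>') + l (coad br UNIV z \<xi>')
       - \<omega> z' \<xi> - br z' (l \<xi>) - l (coad br UNIV z' \<xi>)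
       + br (l \<xi>) (l \<xi>') + l (coad br UNIV (l \<xi>) \<xi>') - l (coad br UNIV (l \<xi>') \<xi>)
       + \<omega> (l \<xi>) \<xi>' - \<omega> (l \<xi>') \<xi>
       - vec_of s (\<lambda>\<zeta>. \<xi> (\<omega> (l \<zeta>) \<xi>')) + vec_of s (\<phi> \<xi> \<xi>'),
     - coad br UNIV z \<xi>' + coad br UNIV z' \<xi> - (\<lambda>x. \<xi> (\<omega> x \<xi>'))
       - coad br UNIV (l \<xi>) \<xi>' + coad br UNIV (l \<xi>') \<xi>))"

end

theory Submission
  imports Defs
begin

text \<open>
  The form of the double is invariant, so the Jacobiator paired with a fourth element is an
  alternating \<open>4\<close>-form. On arguments of which at least one lies in the Lie algebra, this form
  vanishes by the Jacobi identity, the cocycle condition and the hypothesis on \<open>ad\<^sup>(\<^sup>3\<^sup>)\<phi>\<close>.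
  Twisting by \<open>l\<^sub>q\<close> is transport along the isometry \<open>x + \<xi> \<mapsto> x + l\<^sub>q\<xi> + \<xi>\<close>, which fixes the
  Lie algebra, so that after the twist only the values on four covectors remain. There the
  dynamical Yang-Baxter equation turns the twisted \<open>\<phi>\<close> into the cyclic sum of \<open>dl\<close>, and its derivative
  at \<open>q\<close>, alternated over four covectors, loses its second-order terms because second derivatives
  are symmetric; what is left is the missing identity.
  In the same way the equivariance of \<open>l\<close> and the Yang-Baxter equation at \<open>q\<close> show that the
  \<open>\<gg>\<close>-component of a bracket of elements \<open>z + \<xi>\<close>, \<open>z' + \<xi>'\<close> of the subspace is \<open>[z, z']\<close> plus the element
  of \<open>\<ll>\<close> representing \<open>v \<mapsto> \<langle>\<xi>', d\<^sub>ql(v)\<xi>\<rangle>\<close>.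
\<close>

section \<open>Finite-dimensional spaces and duals\<close>

text \<open>The hypotheses on \<open>\<omega>\<close> and \<open>\<phi>\<close> do not include the
  component of the Jacobi identity on four covectors, so there is no Lie quasi-bialgebra at hand
  that could simply be twisted. What is transported is the form \<open>jac\<close>, which makes
  sense for any bracket of this shape, and the missing component is proved after the twist. There
  the Yang-Baxter equation acts twice: as it stands, to rewrite the twisted form, and
  differentiated, to remove what is left. Contracting the twisted form with the covector part of a
  bracket also produces differentials of \<open>l\<close> in directions that come from the twisted
  cocycle. Equivariance makes these directions coadjoint, and reflexivity of the subalgebra turns
  them into values of \<open>q\<close> on brackets. A second obstacle is analytic: smoothness is
  expressed by functionals and iterated directional derivatives. That the differential exists as a
  vector, is linear in the direction and has symmetric second derivatives must all be derived from
  this.\<close>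

lemma dscale_apply [simp]: "dscale c f x = c * f x"
  by (simp add: dscale_def)

lemma restr_apply: "x \<in> V \<Longrightarrow> restr V f x = f x"
  by (simp add: restr_def)

lemma restr_UNIV [simp]: "restr UNIV f = f"
  by (simp add: restr_def)

lemma vector_space_dscale: "vector_space (dscale :: 'k::{real_normed_field,euclidean_space} \<Rightarrow> ('v \<Rightarrow> 'k) \<Rightarrow> _)"
  by unfold_locales (auto simp: dscale_def fun_eq_iff algebra_simps)

lemma linear_mapI:
  assumes "\<And>x. x \<in> V \<Longrightarrow> f x \<in> W"
    and "\<And>x y. x \<in> V \<Longrightarrow> y \<in> V \<Longrightarrow> f (x + y) = f x + f y"
    and "\<And>c x. x \<in> V \<Longrightarrow> f (s c x) = s' c (f x)"
  shows "linear_map s V s' W f"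
  using assms by (auto simp: linear_map_def)

lemma linear_map_add: "linear_map s V s' W f \<Longrightarrow> x \<in> V \<Longrightarrow> y \<in> V \<Longrightarrow> f (x + y) = f x + f y"
  and linear_map_scale: "linear_map s V s' W f \<Longrightarrow> x \<in> V \<Longrightarrow> f (s c x) = s' c (f x)"
  by (auto simp: linear_map_def)

lemma dualI:
  assumes "\<And>x y. x \<in> V \<Longrightarrow> y \<in> V \<Longrightarrow> f (x + y) = f x + f y"
    and "\<And>c x. x \<in> V \<Longrightarrow> f (s c x) = c * f x"
    and "\<And>x. x \<notin> V \<Longrightarrow> f x = 0"
  shows "f \<in> dual s V"
  using assms by (auto simp: dual_def linear_map_def)

lemma dual_UNIV_I:
  assumes "\<And>x y. f (x + y) = f x + f y" and "\<And>c x. f (s c x) = c * f x"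
  shows "f \<in> dual s UNIV"
  using assms by (auto intro: dualI)

lemma dual_add: "f \<in> dual s V \<Longrightarrow> x \<in> V \<Longrightarrow> y \<in> V \<Longrightarrow> f (x + y) = f x + f y"
  and dual_scale: "f \<in> dual s V \<Longrightarrow> x \<in> V \<Longrightarrow> f (s c x) = c * f x"
  and dual_outside: "f \<in> dual s V \<Longrightarrow> x \<notin> V \<Longrightarrow> f x = 0"
  by (auto simp: dual_def linear_map_def)

lemma subspace_dual: "module.subspace dscale (dual s V)"
proof -
  interpret vector_space dscale by (rule vector_space_dscale)
  show ?thesis
    by (rule subspaceI) (auto simp: dual_def linear_map_def algebra_simps)
qed

lemma dual_closed [intro]:
  shows "0 \<in> dual s V"
    and "f \<in> dual s V \<Longrightarrow> g \<in> dual s V \<Longrightarrow> f + g \<in> dual s V"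
    and "f \<in> dual s V \<Longrightarrow> g \<in> dual s V \<Longrightarrow> f - g \<in> dual s V"
    and "f \<in> dual s V \<Longrightarrow> - f \<in> dual s V"
    and "f \<in> dual s V \<Longrightarrow> dscale c f \<in> dual s V"
proof -
  interpret vector_space dscale by (rule vector_space_dscale)
  note S = subspace_dual[of s V]
  show "0 \<in> dual s V" by (rule subspace_0[OF S])
  show "f \<in> dual s V \<Longrightarrow> g \<in> dual s V \<Longrightarrow> f + g \<in> dual s V" by (rule subspace_add[OF S])
  show "f \<in> dual s V \<Longrightarrow> g \<in> dual s V \<Longrightarrow> f - g \<in> dual s V" by (rule subspace_diff[OF S])
  show "f \<in> dual s V \<Longrightarrow> - f \<in> dual s V" by (rule subspace_neg[OF S])
  show "f \<in> dual s V \<Longrightarrow> dscale c f \<in> dual s V" by (rule subspace_scale[OF S])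
qed

lemma fd_space_subspace:
  assumes "fd_space s V" "module.subspace s W" "W \<subseteq> V"
  shows "fd_space s W"
proof -
  interpret vector_space s using assms(1) by (simp add: fd_space_def)
  obtain B where B: "finite B" "span B = V" using assms(1) by (auto simp: fd_space_def)
  obtain C where C: "C \<subseteq> W" "independent C" "W \<subseteq> span C" using maximal_independent_subset by blast
  have "finite C"
    using independent_span_bound[OF B(1) C(2)] B(2) C(1) assms(3) by auto
  moreover have "span C = W"
    using C assms(2) by (simp add: span_subspace)
  ultimately show ?thesis
    using assms(2) vector_space_axioms by (auto simp: fd_space_def)
qed

lemma finite_basis_exists:
  assumes "fd_space s V"
  obtains B where "finite B" "B \<subseteq> V" "\<not> module.dependent s B" "module.span s B = V"
proof -
  interpret vector_space s using assms by (simp add: fd_space_def)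
  obtain B where B: "finite B" "span B = V" using assms by (auto simp: fd_space_def)
  obtain C where C: "C \<subseteq> V" "independent C" "V \<subseteq> span C" using maximal_independent_subset by blast
  have "finite C"
    using independent_span_bound[OF B(1) C(2)] B(2) C(1) by auto
  moreover have "span C = V"
    using C assms by (simp add: fd_space_def span_subspace)
  ultimately show ?thesis using that C by blast
qed

locale fd_type =
  fixes s :: "'k::{real_normed_field,euclidean_space} \<Rightarrow> 'g::ab_group_add \<Rightarrow> 'g"
  assumes fd_UNIV: "fd_space s UNIV"
begin

sublocale vector_space s
  using fd_UNIV by (simp add: fd_space_def)

abbreviation "gd \<equiv> dual s UNIV"

sublocale vs_k: vector_space_pair s "(*) :: 'k \<Rightarrow> 'k \<Rightarrow> 'k"
  by unfold_locales (auto simp: algebra_simps)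

lemma vector_space_k: "vector_space ((*) :: 'k \<Rightarrow> 'k \<Rightarrow> 'k)"
  by unfold_locales (auto simp: algebra_simps)

lemma dual_iff_linear: "f \<in> gd \<longleftrightarrow> Vector_Spaces.linear s (*) f"
  by (auto simp: dual_def linear_map_def Vector_Spaces.linear_iff vector_space_k vector_space_axioms)

lemma gd_simps:
  assumes "f \<in> gd"
  shows "f (x + y) = f x + f y" "f (s c x) = c * f x" "f 0 = 0" "f (- x) = - f x" "f (x - y) = f x - f y"
  using assms vs_k.linear_add vs_k.linear_scale vs_k.linear_0 vs_k.linear_neg vs_k.linear_diff
  by (auto simp: dual_iff_linear)

lemma gd_sum: "f \<in> gd \<Longrightarrow> f (\<Sum>i\<in>I. x i) = (\<Sum>i\<in>I. f (x i))"
  by (simp add: dual_iff_linear vs_k.linear_sum)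

text \<open>The resolution of the identity is the form in which a basis gets used: substituting it
  turns linear and bilinear expressions into finite sums of scalars.\<close>

lemma dual_basis_exists:
  obtains B \<delta> where "finite B" "\<And>b. b \<in> B \<Longrightarrow> \<delta> b \<in> gd" "\<And>x. x = (\<Sum>b\<in>B. s (\<delta> b x) b)"
proof -
  obtain B where B: "finite B" "independent B" "span B = UNIV"
    using finite_basis_exists[OF fd_UNIV] by auto
  show thesis
  proof (rule that[of B "\<lambda>b x. representation B x b"])
    show "(\<lambda>x. representation B x b) \<in> gd" if "b \<in> B" for b
      using B by (auto intro!: dual_UNIV_I simp: representation_add representation_scale)
    show "x = (\<Sum>b\<in>B. s (representation B x b) b)" for x
      using B by (simp add: sum_representation_eq)
  qed (fact B)
qed

lemma dual_expansion:
  assumes f: "f \<in> gd" and B: "\<And>x. x = (\<Sum>b\<in>B. s (\<delta> b x) b)"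
  shows "f = (\<Sum>b\<in>B. dscale (f b) (\<delta> b))"
proof
  fix x
  have "f x = f (\<Sum>b\<in>B. s (\<delta> b x) b)" by (rule arg_cong[OF B])
  also have "\<dots> = (\<Sum>b\<in>B. f b * \<delta> b x)" using f by (simp add: gd_sum gd_simps mult.commute)
  also have "\<dots> = (\<Sum>b\<in>B. dscale (f b) (\<delta> b)) x"
    by (induction B rule: infinite_finite_induct) auto
  finally show "f x = (\<Sum>b\<in>B. dscale (f b) (\<delta> b)) x" .
qed

lemma separating:
  assumes "\<And>f. f \<in> gd \<Longrightarrow> f x = f y"
  shows "x = y"
proof -
  obtain B \<delta> where B: "\<And>b. b \<in> B \<Longrightarrow> \<delta> b \<in> gd" "\<And>x. x = (\<Sum>b\<in>B. s (\<delta> b x) b)"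
    using dual_basis_exists by metis
  have "x = (\<Sum>b\<in>B. s (\<delta> b x) b)" by (rule B)
  also have "\<dots> = (\<Sum>b\<in>B. s (\<delta> b y) b)" using assms[OF B(1)] by (intro sum.cong) simp_all
  also have "\<dots> = y" by (rule B(2)[symmetric])
  finally show ?thesis .
qed

text \<open>Linearity is known on \<open>gd\<close> and not on the whole function type, so
  membership of the partial sums has to travel through the induction; hence the conjunction.\<close>

lemma linear_map_sum:
  assumes F: "linear_map dscale gd s' W F" and "finite I" "\<And>i. i \<in> I \<Longrightarrow> f i \<in> gd" and s': "vector_space s'"
  shows "(\<Sum>i\<in>I. f i) \<in> gd \<and> F (\<Sum>i\<in>I. f i) = (\<Sum>i\<in>I. F (f i))"
  using assms(2,3)
proof (induction rule: finite_induct)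
  case empty
  interpret s': vector_space s' by fact
  have "F (dscale 0 0) = s' 0 (F 0)" by (rule linear_map_scale[OF F]) auto
  moreover have "dscale (0::'k) (0::'g \<Rightarrow> 'k) = 0" by (simp add: fun_eq_iff)
  ultimately have "F 0 = 0" by (simp only: s'.scale_zero_left)
  then show ?case unfolding sum.empty using dual_closed(1) by blast
next
  case (insert i I)
  then have "f i \<in> gd" "sum f I \<in> gd" "F (sum f I) = (\<Sum>i\<in>I. F (f i))" by auto
  with dual_closed(2) linear_map_add[OF F] show ?case
    unfolding sum.insert[OF insert.hyps] by metis
qed

lemma bidual:
  assumes F: "linear_map dscale gd (*) UNIV F"
  obtains u where "\<And>f. f \<in> gd \<Longrightarrow> f u = F f"
proof -
  obtain B \<delta> where B: "finite B" "\<And>b. b \<in> B \<Longrightarrow> \<delta> b \<in> gd" "\<And>x. x = (\<Sum>b\<in>B. s (\<delta> b x) b)"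
    using dual_basis_exists by metis
  show thesis
  \<comment> \<open>The witness is forced: expanding \<open>f\<close> in the
    \<open>\<delta> b\<close> with coefficients \<open>f b\<close> shows that the coordinates of the
    vector must be \<open>F (\<delta> b)\<close>.\<close>
  proof (rule that[of "\<Sum>b\<in>B. s (F (\<delta> b)) b"])
    fix f assume f: "f \<in> gd"
    have "f = (\<Sum>b\<in>B. dscale (f b) (\<delta> b))" by (rule dual_expansion[OF f B(3)])
    then have "F f = F (\<Sum>b\<in>B. dscale (f b) (\<delta> b))" by simp
    also have "\<dots> = (\<Sum>b\<in>B. F (dscale (f b) (\<delta> b)))"
      using linear_map_sum[OF F B(1), of "\<lambda>b. dscale (f b) (\<delta> b)"] B(2) vector_space_k by blast
    also have "\<dots> = (\<Sum>b\<in>B. f b * F (\<delta> b))"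
      using B(2) by (simp add: linear_map_scale[OF F])
    also have "\<dots> = f (\<Sum>b\<in>B. s (F (\<delta> b)) b)"
      using f by (simp add: gd_sum gd_simps mult.commute)
    finally show "f (\<Sum>b\<in>B. s (F (\<delta> b)) b) = F f" by simp
  qed
qed

text \<open>The description by THE is dealt with here once; afterwards \<open>vec_of\<close> is
  handled through its pairings with covectors.\<close>

lemma vec_of_apply:
  assumes F: "linear_map dscale gd (*) UNIV F" and f: "f \<in> gd"
  shows "f (vec_of s F) = F f"
proof -
  obtain u where u: "\<And>f. f \<in> gd \<Longrightarrow> f u = F f" using bidual[OF F] by blast
  have "vec_of s F = u"
    unfolding vec_of_def
  proof (rule the_equality)
    show "\<forall>\<zeta>\<in>gd. \<zeta> u = F \<zeta>" using u by blast
    show "v = u" if "\<forall>\<zeta>\<in>gd. \<zeta> v = F \<zeta>" for v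
      using that u by (intro separating) simp
  qed
  then show ?thesis using u f by simp
qed

text \<open>A basis of \<open>W\<close> stays independent when \<open>u\<close> is adjoined, so the
  values 0 on it and 1 at \<open>u\<close> can be prescribed. Such covectors later detect membership
  in \<open>W\<close>.\<close>

lemma annihilator:
  assumes W: "subspace W" and u: "u \<notin> W"
  obtains f where "f \<in> gd" "\<And>w. w \<in> W \<Longrightarrow> f w = 0" "f u = 1"
proof -
  obtain B where B: "B \<subseteq> W" "independent B" "W \<subseteq> span B" using maximal_independent_subset by blast
  have spB: "span B = W" using B W by (simp add: span_subspace)
  have ind: "independent (insert u B)" using B u spB by (simp add: independent_insertI)
  let ?g = "\<lambda>x. if x = u then (1::'k) else 0"
  obtain f where f: "Vector_Spaces.linear s (*) f" "\<And>x. x \<in> insert u B \<Longrightarrow> f x = ?g x"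
    using vs_k.linear_independent_extend[OF ind, of ?g] by blast
  have "f w = 0" if "w \<in> W" for w
  proof -
    have "w \<in> span B" using that spB by simp
    moreover have "Vector_Spaces.linear s (*) (\<lambda>x. 0::'k)" by (simp add: Vector_Spaces.linear_iff vector_space_k vector_space_axioms)
    moreover have "f b = 0" if "b \<in> B" for b using f(2)[of b] that u B(1) by auto
    ultimately show ?thesis using vs_k.linear_eq_on[OF f(1)] by blast
  qed
  moreover have "f u = 1" using f(2)[of u] by simp
  ultimately show thesis using that f(1) dual_iff_linear by blast
qed

lemma extension:
  assumes W: "subspace W" and p: "p \<in> dual s W"
  obtains f where "f \<in> gd" "restr W f = p"
proof -
  obtain B where B: "B \<subseteq> W" "independent B" "W \<subseteq> span B" using maximal_independent_subset by blast
  have spB: "span B = W" using B W by (simp add: span_subspace)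
  obtain f where f: "Vector_Spaces.linear s (*) f" "\<And>x. x \<in> B \<Longrightarrow> f x = p x"
    using vs_k.linear_independent_extend[OF B(2), of p] by auto
  then have fd: "f \<in> gd" by (simp add: dual_iff_linear)
  have p0: "p 0 = 0" using dual_scale[OF p subspace_0[OF W], of 0] by simp
  have "span B \<subseteq> {v \<in> W. f v = p v}"
  proof (rule span_minimal)
    show "subspace {v \<in> W. f v = p v}"
      using W p p0 fd subspace_0[OF W] subspace_add[OF W] subspace_scale[OF W]
      by (auto simp: subspace_def dual_add dual_scale gd_simps)
  qed (use B f in auto)
  then have "restr W f = p"
    using spB dual_outside[OF p] by (auto simp: restr_def fun_eq_iff)
  then show thesis using that fd by blast
qed

lemma restr_in_dual:
  assumes "subspace W" "f \<in> gd" shows "restr W f \<in> dual s W"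
  using assms by (auto intro!: dualI simp: restr_def gd_simps subspace_add subspace_scale)

text \<open>Reflexivity of \<open>W\<close> follows from that of the ambient space: pull
  \<open>F\<close> back along restriction and represent it by some \<open>u\<close>. The pulled-back
  functional kills every covector vanishing on \<open>W\<close>, which forces \<open>u\<close> into
  \<open>W\<close>.\<close>

lemma bidual_subspace:
  assumes W: "subspace W" and F: "linear_map dscale (dual s W) (*) UNIV F"
  obtains u where "u \<in> W" "\<And>p. p \<in> dual s W \<Longrightarrow> p u = F p"
proof -
  have r: "restr W f \<in> dual s W" if "f \<in> gd" for f using restr_in_dual[OF W that] .
  have "linear_map dscale gd (*) UNIV (\<lambda>f. F (restr W f))"
  proof (rule linear_mapI)
    fix f g c assume fg: "f \<in> gd" "g \<in> gd"
    have "restr W (f + g) = restr W f + restr W g" by (auto simp: restr_def fun_eq_iff)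
    then show "F (restr W (f + g)) = F (restr W f) + F (restr W g)"
      using linear_map_add[OF F r r] fg by simp
  next
    fix f c assume fg: "f \<in> gd"
    have "restr W (dscale c f) = dscale c (restr W f)" by (auto simp: restr_def fun_eq_iff)
    then show "F (restr W (dscale c f)) = c * F (restr W f)"
      using linear_map_scale[OF F r] fg by simp
  qed auto
  then obtain u where u: "\<And>f. f \<in> gd \<Longrightarrow> f u = F (restr W f)" using bidual by blast
  have "0 \<in> dual s W" by auto
  from linear_map_scale[OF F this, of 0] have F0: "F 0 = 0" by (simp add: dscale_def zero_fun_def)
  have uW: "u \<in> W"
  proof (rule ccontr)
    assume "u \<notin> W"
    then obtain f where f: "f \<in> gd" "\<And>w. w \<in> W \<Longrightarrow> f w = 0" "f u = 1" using annihilator[OF W] by blast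
    then have "restr W f = 0" by (auto simp: restr_def fun_eq_iff)
    then show False using u[OF f(1)] f(3) F0 by simp
  qed
  show thesis
  proof (rule that[OF uW])
    fix p assume "p \<in> dual s W"
    then obtain f where "f \<in> gd" "restr W f = p" using extension[OF W] by blast
    then show "p u = F p" using u[of f] uW by (auto simp: restr_def)
  qed
qed

lemma vector_space_pscale: "vector_space (pscale s (dscale :: 'k \<Rightarrow> ('g \<Rightarrow> 'k) \<Rightarrow> _))"
proof -
  interpret d: vector_space "dscale :: 'k \<Rightarrow> ('g \<Rightarrow> 'k) \<Rightarrow> _" by (rule vector_space_dscale)
  show ?thesis
    by unfold_locales (auto simp: pscale_def scale_right_distrib scale_left_distrib d.scale_right_distrib d.scale_left_distrib)
qed

lemma fd_double: "fd_space (pscale s dscale) (double_carrier s)"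
proof -
  interpret d: vector_space "dscale :: 'k \<Rightarrow> ('g \<Rightarrow> 'k) \<Rightarrow> _" by (rule vector_space_dscale)
  interpret p: vector_space "pscale s (dscale :: 'k \<Rightarrow> ('g \<Rightarrow> 'k) \<Rightarrow> _)" by (rule vector_space_pscale)
  have sub: "p.subspace (double_carrier s)"
    by (rule p.subspaceI) (auto simp: pscale_def zero_prod_def)
  obtain B \<delta> where B: "finite B" "\<And>b. b \<in> B \<Longrightarrow> \<delta> b \<in> gd" "\<And>x. x = (\<Sum>b\<in>B. s (\<delta> b x) b)"
    using dual_basis_exists by metis
  let ?C = "(\<lambda>b. (b, 0)) ` B \<union> (\<lambda>b. (0, \<delta> b)) ` B"
  have "p.span ?C = double_carrier s"
  proof
    show "p.span ?C \<subseteq> double_carrier s"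
      by (rule p.span_minimal[OF _ sub]) (use B in auto)
    show "double_carrier s \<subseteq> p.span ?C"
    proof clarify
      fix x f assume f: "f \<in> gd"
      have "f = (\<Sum>b\<in>B. dscale (f b) (\<delta> b))" by (rule dual_expansion[OF f B(3)])
      moreover have "(\<Sum>b\<in>B. pscale s dscale (\<delta> b x) (b, 0)) + (\<Sum>b\<in>B. pscale s dscale (f b) (0, \<delta> b))
        = (\<Sum>b\<in>B. s (\<delta> b x) b, \<Sum>b\<in>B. dscale (f b) (\<delta> b))"
        unfolding pscale_def by (simp add: sum_prod)
      ultimately have "(x, f) = (\<Sum>b\<in>B. pscale s dscale (\<delta> b x) (b, 0)) + (\<Sum>b\<in>B. pscale s dscale (f b) (0, \<delta> b))"
        using B(3)[of x] by simp
      also have "\<dots> \<in> p.span ?C"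
        by (intro p.span_add p.span_sum p.span_scale p.span_base) auto
      finally show "(x, f) \<in> p.span ?C" .
    qed
  qed
  moreover have "finite ?C" using B by auto
  ultimately show ?thesis using sub p.vector_space_axioms by (auto simp: fd_space_def)
qed

end

section \<open>Directional derivatives\<close>

text \<open>Two applications of the mean value theorem: in \<open>a\<close> to the difference of the
  slices \<open>b = h\<close> and \<open>b = 0\<close>, then in \<open>b\<close> to the resulting
  first partial derivative.\<close>

lemma second_difference_mvt:
  fixes f fa fab :: "real \<Rightarrow> real \<Rightarrow> real"
  assumes h: "0 < h" "h < e"
    and fa: "\<And>a b. \<bar>a\<bar> < e \<Longrightarrow> \<bar>b\<bar> < e \<Longrightarrow> ((\<lambda>a. f a b) has_real_derivative fa a b) (at a)"
    and fab: "\<And>a b. \<bar>a\<bar> < e \<Longrightarrow> \<bar>b\<bar> < e \<Longrightarrow> ((\<lambda>b. fa a b) has_real_derivative fab a b) (at b)"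
  obtains x y where "0 < x" "x < h" "0 < y" "y < h" "f h h - f h 0 - f 0 h + f 0 0 = h * h * fab x y"
proof -
  have "\<exists>x. 0 < x \<and> x < h \<and> (f h h - f h 0) - (f 0 h - f 0 0) = (h - 0) * (fa x h - fa x 0)"
    by (rule MVT2[OF h(1)]) (use h in \<open>auto intro!: DERIV_diff fa\<close>)
  then obtain x where x: "0 < x" "x < h" "(f h h - f h 0) - (f 0 h - f 0 0) = (h - 0) * (fa x h - fa x 0)"
    by blast
  have "\<exists>y. 0 < y \<and> y < h \<and> fa x h - fa x 0 = (h - 0) * fab x y"
    by (rule MVT2[OF h(1)]) (use h x in \<open>auto intro!: fab\<close>)
  then obtain y where "0 < y" "y < h" "fa x h - fa x 0 = (h - 0) * fab x y" by blast
  with x show thesis using that[of x y] by (simp add: algebra_simps)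
qed

text \<open>The second difference over a small square is symmetric in the two variables. Computed in
  either order it equals \<open>h * h\<close> times a value of \<open>fab\<close>, respectively
  \<open>fba\<close>, inside the square, and continuity at the origin makes the two limits
  agree.\<close>

lemma mixed_partials_real:
  fixes f fa fb fab fba :: "real \<Rightarrow> real \<Rightarrow> real"
  assumes e: "0 < e"
    and fa: "\<And>a b. \<bar>a\<bar> < e \<Longrightarrow> \<bar>b\<bar> < e \<Longrightarrow> ((\<lambda>a. f a b) has_real_derivative fa a b) (at a)"
    and fab: "\<And>a b. \<bar>a\<bar> < e \<Longrightarrow> \<bar>b\<bar> < e \<Longrightarrow> ((\<lambda>b. fa a b) has_real_derivative fab a b) (at b)"
    and fb: "\<And>a b. \<bar>a\<bar> < e \<Longrightarrow> \<bar>b\<bar> < e \<Longrightarrow> ((\<lambda>b. f a b) has_real_derivative fb a b) (at b)"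
    and fba: "\<And>a b. \<bar>a\<bar> < e \<Longrightarrow> \<bar>b\<bar> < e \<Longrightarrow> ((\<lambda>a. fb a b) has_real_derivative fba a b) (at a)"
    and cont: "isCont (\<lambda>z. fab (fst z) (snd z)) (0, 0)" "isCont (\<lambda>z. fba (fst z) (snd z)) (0, 0)"
  shows "fab 0 0 = fba 0 0"
proof (rule ccontr)
  assume "fab 0 0 \<noteq> fba 0 0"
  define \<epsilon> where "\<epsilon> = \<bar>fab 0 0 - fba 0 0\<bar> / 2"
  have \<epsilon>: "\<epsilon> > 0" using \<open>fab 0 0 \<noteq> fba 0 0\<close> by (simp add: \<epsilon>_def)
  obtain d1 where d1: "d1 > 0" "\<And>z. dist z (0, 0) < d1 \<Longrightarrow> dist (fab (fst z) (snd z)) (fab 0 0) < \<epsilon>"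
    using cont(1) \<epsilon> unfolding continuous_at_eps_delta by fastforce
  obtain d2 where d2: "d2 > 0" "\<And>z. dist z (0, 0) < d2 \<Longrightarrow> dist (fba (fst z) (snd z)) (fba 0 0) < \<epsilon>"
    using cont(2) \<epsilon> unfolding continuous_at_eps_delta by fastforce
  \<comment> \<open>Halving the minimum leaves room for the estimate of the Euclidean norm by the
    sum of coordinates: points of the open square of side \<open>h\<close> lie within
    \<open>2 * h\<close> of the origin.\<close>
  define h where "h = Min {e, d1, d2} / 2"
  have h: "0 < h" "h < e" "2 * h \<le> d1" "2 * h \<le> d2" using e d1(1) d2(1) by (auto simp: h_def)
  have small: "dist (x, y) (0, 0) < 2 * h" if "0 < x" "x < h" "0 < y" "y < h" for x y :: real
    using sqrt_sum_squares_le_sum_abs[of x y] that by (simp add: dist_prod_def dist_real_def)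
  obtain x y where xy: "0 < x" "x < h" "0 < y" "y < h" "f h h - f h 0 - f 0 h + f 0 0 = h * h * fab x y"
    using second_difference_mvt[OF h(1,2) fa fab] by blast
  obtain y' x' where xy': "0 < y'" "y' < h" "0 < x'" "x' < h"
    "f h h - f 0 h - f h 0 + f 0 0 = h * h * fba x' y'"
    using second_difference_mvt[where f = "\<lambda>b a. f a b" and fa = "\<lambda>b a. fb a b" and fab = "\<lambda>b a. fba a b",
      OF h(1,2)] fb fba by metis
  have "h * h * fab x y = h * h * fba x' y'" using xy(5) xy'(5) by linarith
  then have "fab x y = fba x' y'" using h(1) by simp
  moreover have "dist (fab x y) (fab 0 0) < \<epsilon>" using d1(2)[of "(x, y)"] small[OF xy(1-4)] h by simp
  moreover have "dist (fba x' y') (fba 0 0) < \<epsilon>" using d2(2)[of "(x', y')"] small[OF xy'(3,4,1,2)] h by simp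
  ultimately show False unfolding \<epsilon>_def dist_real_def by (smt (verit) field_sum_of_halves)
qed

text \<open>The mean value theorem concerns real functions of a real variable. Restricting the
  parameter to the real axis and pairing the value with \<open>i\<close> leads there from a
  derivative over the ground field.\<close>

lemma field_derivative_real_component:
  fixes G :: "'k::{real_normed_field,euclidean_space} \<Rightarrow> 'k"
  assumes "(G has_field_derivative D) (at (of_real a))"
  shows "((\<lambda>x::real. G (of_real x) \<bullet> i) has_real_derivative D \<bullet> i) (at a)"
proof -
  have G: "(G has_derivative (*) D) (at (of_real a))"
    using assms by (simp add: has_field_derivative_def)
  have "((of_real :: real \<Rightarrow> 'k) has_derivative of_real) (at a)"
    by (rule bounded_linear.has_derivative[OF bounded_linear_of_real has_derivative_ident])
  from has_derivative_compose[OF this G]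
  have "((\<lambda>x. G (of_real x) \<bullet> i) has_derivative (\<lambda>h. (D * of_real h) \<bullet> i)) (at a)"
    by (rule has_derivative_inner_left)
  moreover have "(D * of_real h) \<bullet> i = (D \<bullet> i) * h" for h
    by (simp add: mult.commute[of D] inner_scaleR_left flip: scaleR_conv_of_real)
  ultimately show ?thesis by (simp add: has_field_derivative_def)
qed

section \<open>Calculus on an open subset, along lines and two-parameter planes\<close>

locale open_in_space =
  fixes s :: "'k::{real_normed_field,euclidean_space} \<Rightarrow> 'v::ab_group_add \<Rightarrow> 'v" and V U
  assumes vector_space: "vector_space s" and subspace_V: "module.subspace s V"
    and openin_U: "openin (fd_top s V) U"
begin

sublocale vector_space s by (rule vector_space)

lemma U_subset: "U \<subseteq> V"
proof -
  have "topspace (fd_top s V) \<subseteq> V" by (auto simp: fd_top_def)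
  then show ?thesis using openin_U openin_subset by blast
qed

text \<open>The topology is generated by functionals, and composed with a functional the plane
  becomes an affine scalar function of the two parameters.\<close>

lemma continuous_plane:
  assumes p: "p \<in> V" "u \<in> V" "v \<in> V"
  shows "continuous_map euclidean (fd_top s V) (\<lambda>z. p + s (fst z) u + s (snd z) v)"
  unfolding fd_top_def
proof (rule continuous_on_generated_topo)
  have inV: "p + s a u + s b v \<in> V" for a b
    using p subspace_V by (simp add: subspace_add subspace_scale)
  fix W assume "W \<in> {{x \<in> V. f x \<in> S} |f S. f \<in> dual s V \<and> open S}"
  then obtain f S where W: "W = {x \<in> V. f x \<in> S}" and f: "f \<in> dual s V" and S: "open S" by blast
  have "f (p + s a u + s b v) = f p + a * f u + b * f v" for a b
    using p f subspace_V by (simp add: dual_add dual_scale subspace_add subspace_scale)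
  then have "(\<lambda>z. p + s (fst z) u + s (snd z) v) -` W = (\<lambda>z. f p + fst z * f u + snd z * f v) -` S"
    using inV by (auto simp: W)
  moreover have "open ((\<lambda>z. f p + fst z * f u + snd z * f v) -` S)"
    by (rule open_vimage[OF S]) (intro continuous_intros)
  ultimately show "openin euclidean ((\<lambda>z. p + s (fst z) u + s (snd z) v) -` W \<inter> topspace euclidean)"
    by simp
next
  have inV: "p + s a u + s b v \<in> V" for a b
    using p subspace_V by (simp add: subspace_add subspace_scale)
  \<comment> \<open>\<open>V\<close> itself is a generator: the preimage of the whole field under
    the zero functional.\<close>
  have "V \<in> {{x \<in> V. f x \<in> S} |f S. f \<in> dual s V \<and> open S}"
    using dual_closed(1)[of s V] by (intro CollectI exI[of _ 0] exI[of _ UNIV]) auto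
  with inV show "(\<lambda>z. p + s (fst z) u + s (snd z) v) ` topspace euclidean
      \<subseteq> \<Union> {{x \<in> V. f x \<in> S} |f S. f \<in> dual s V \<and> open S}" by blast
qed

lemma plane_preimage_open:
  assumes "p \<in> V" "u \<in> V" "v \<in> V"
  shows "open {z. p + s (fst z) u + s (snd z) v \<in> U}"
  using openin_continuous_map_preimage[OF continuous_plane[OF assms] openin_U] by simp

lemma plane_neighbourhood:
  assumes p: "p \<in> U" and uv: "u \<in> V" "v \<in> V"
  obtains e where "e > 0" "\<And>a b. norm a < e \<Longrightarrow> norm b < e \<Longrightarrow> p + s a u + s b v \<in> U"
proof -
  have "open {z. p + s (fst z) u + s (snd z) v \<in> U}"
    using plane_preimage_open p uv U_subset by blast
  moreover have "(0, 0) \<in> {z. p + s (fst z) u + s (snd z) v \<in> U}" using p by simp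
  ultimately obtain A B where AB: "open A" "open B" "(0, 0) \<in> A \<times> B" "A \<times> B \<subseteq> {z. p + s (fst z) u + s (snd z) v \<in> U}"
    by (rule open_prod_elim)
  obtain e1 e2 where "e1 > 0" "ball 0 e1 \<subseteq> A" "e2 > 0" "ball 0 e2 \<subseteq> B"
    using AB open_contains_ball by (metis mem_Sigma_iff)
  then show thesis using AB(4) that[of "min e1 e2"]
    by (force simp: subset_iff)
qed

lemma eventually_line:
  assumes p: "p \<in> U" and u: "u \<in> V"
  shows "\<forall>\<^sub>F t in nhds 0. p + s t u \<in> U"
proof -
  obtain e where e: "e > 0" "\<And>a b. norm a < e \<Longrightarrow> norm b < e \<Longrightarrow> p + s a u + s b u \<in> U"
    using plane_neighbourhood[OF p u u] by blast
  have "p + s t u \<in> U" if "dist t 0 < e" for t using e(2)[of t 0] e(1) that by simp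
  then show ?thesis using e(1) by (auto simp: eventually_nhds_metric)
qed

lemma isCont_plane:
  assumes F: "Ck_on 0 s V U F" and p: "p \<in> U" and uv: "u \<in> V" "v \<in> V"
  shows "isCont (\<lambda>z. F (p + s (fst z) u + s (snd z) v)) (0, 0)"
proof -
  let ?h = "\<lambda>z. p + s (fst z) u + s (snd z) v"
  let ?Q = "{z. ?h z \<in> U}"
  have pV: "p \<in> V" using p U_subset by blast
  have "continuous_map (top_of_set ?Q) (subtopology (fd_top s V) U) ?h"
    using continuous_map_from_subtopology[OF continuous_plane[OF pV uv]]
    by (auto simp: continuous_map_in_subtopology)
  from continuous_map_compose[OF this F[unfolded Ck_on.simps]]
  have "continuous_map (top_of_set ?Q) euclidean (F \<circ> ?h)" .
  then have "continuous_on ?Q (\<lambda>z. F (?h z))" by (simp add: o_def)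
  moreover have "open ?Q" using plane_preimage_open pV uv by blast
  moreover have "(0, 0) \<in> ?Q" using p by simp
  ultimately show ?thesis using continuous_on_eq_continuous_at by blast
qed

text \<open>\<open>Ck_on\<close> provides derivatives at parameter 0 for every base point. Shifting
  the parameter converts them into derivatives at every point of one fixed line, which the
  two-parameter arguments require.\<close>

lemma derivative_along_line:
  assumes "((\<lambda>t. F (p + s a u + s t u)) has_field_derivative D) (at 0)"
  shows "((\<lambda>t. F (p + s t u)) has_field_derivative D) (at a)"
proof -
  have "((\<lambda>t. F (p + s (t + a) u)) has_field_derivative D) (at 0)"
    using assms by (simp add: scale_left_distrib add.assoc add.commute[of "s a u"])
  then show ?thesis using DERIV_shift[of "\<lambda>t. F (p + s t u)" D 0 a] by simp
qed

text \<open>Directional derivatives alone need not be additive in the direction. Continuity of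
  \<open>Fv\<close> makes the function of two parameters differentiable at the origin, and its
  derivative along the diagonal is the sum.\<close>

lemma directional_derivative_add:
  assumes Fu: "\<And>p. p \<in> U \<Longrightarrow> ((\<lambda>t. F (p + s t u)) has_field_derivative Fu p) (at 0)"
    and Fv: "\<And>p. p \<in> U \<Longrightarrow> ((\<lambda>t. F (p + s t v)) has_field_derivative Fv p) (at 0)"
    and cont: "Ck_on 0 s V U Fv" and p: "p \<in> U" and uv: "u \<in> V" "v \<in> V"
  shows "((\<lambda>t. F (p + s t (u + v))) has_field_derivative Fu p + Fv p) (at 0)"
proof -
  obtain e where e: "e > 0" "\<And>a b. norm a < e \<Longrightarrow> norm b < e \<Longrightarrow> p + s a u + s b v \<in> U"
    using plane_neighbourhood[OF p uv] by blast
  let ?B = "ball (0::'k) e"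
  let ?f = "\<lambda>a b. F (p + s a u + s b v)"
  \<comment> \<open>Multiplication is packaged as a bounded operator because the criterion on
    partial derivatives asks for continuity of the second partial as an operator-valued map.\<close>
  let ?G = "\<lambda>a b. blinfun_mult_right (Fv (p + s a u + s b v))"
  have "((\<lambda>(a, b). ?f a b) has_derivative (\<lambda>(h, k). Fu p * h + blinfun_apply (?G 0 0) k)) (at (0, 0) within ?B \<times> ?B)"
  proof (rule has_derivative_partialsI[where f = ?f and fx = "(*) (Fu p)" and fy = ?G and x = 0 and y = 0])
    show "((\<lambda>a. ?f a 0) has_derivative (*) (Fu p)) (at 0 within ?B)"
      using Fu[OF p] by (auto simp: has_field_derivative_def intro: has_derivative_at_withinI)
    show "((\<lambda>b. ?f a b) has_derivative blinfun_apply (?G a b)) (at b within ?B)" if "a \<in> ?B" "b \<in> ?B" for a b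
    proof -
      have "p + s a u + s b v \<in> U" using e that by simp
      from derivative_along_line[OF Fv[OF this]]
      have "((\<lambda>b. ?f a b) has_field_derivative Fv (p + s a u + s b v)) (at b)" .
      then show ?thesis by (auto simp: has_field_derivative_def blinfun_mult_right.rep_eq intro: has_derivative_at_withinI)
    qed
    have "isCont (\<lambda>z. blinfun_mult_right (Fv (p + s (fst z) u + s (snd z) v))) (0, 0)"
      by (rule bounded_linear.isCont[OF bounded_linear_blinfun_mult_right isCont_plane[OF cont p uv]])
    then show "continuous (at (0, 0) within ?B \<times> ?B) (\<lambda>(a, b). ?G a b)"
      by (auto simp: split_beta' intro: continuous_at_imp_continuous_at_within)
  qed (use e in auto)
  moreover have "at (0, 0) within ?B \<times> ?B = at (0::'k, 0::'k)"
    using e by (intro at_within_open open_Times) auto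
  ultimately have D: "((\<lambda>(a, b). ?f a b) has_derivative (\<lambda>(h, k). Fu p * h + Fv p * k)) (at (0, 0))"
    by (simp add: blinfun_mult_right.rep_eq)
  have "((\<lambda>t::'k. (t, t)) has_derivative (\<lambda>h. (h, h))) (at 0)"
    by (intro has_derivative_Pair has_derivative_ident)
  from has_derivative_compose[OF this D]
  have "((\<lambda>t. ?f t t) has_derivative (\<lambda>h. Fu p * h + Fv p * h)) (at 0)" by simp
  moreover have "(\<lambda>h. Fu p * h + Fv p * h) = (*) (Fu p + Fv p)" by (simp add: fun_eq_iff distrib_right)
  ultimately show ?thesis
    by (simp add: has_field_derivative_def scale_right_distrib add.assoc)
qed

lemma directional_derivative_scale:
  assumes Fu: "((\<lambda>t. F (p + s t u)) has_field_derivative D) (at 0)"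
  shows "((\<lambda>t. F (p + s t (s c u))) has_field_derivative c * D) (at 0)"
proof -
  have "((\<lambda>t::'k. t * c) has_field_derivative c) (at 0)"
    by (auto intro!: derivative_eq_intros)
  from DERIV_chain2[OF _ this, of "\<lambda>t. F (p + s t u)" D] Fu
  show ?thesis by (simp add: mult.commute)
qed

text \<open>Symmetry over the ground field reduces to the real case: compare components along each
  basis element \<open>i\<close> and let both parameters run through the reals only.\<close>

lemma mixed_directional_derivatives:
  assumes Fu: "\<And>p. p \<in> U \<Longrightarrow> ((\<lambda>t. F (p + s t u)) has_field_derivative Fu p) (at 0)"
    and Fv: "\<And>p. p \<in> U \<Longrightarrow> ((\<lambda>t. F (p + s t v)) has_field_derivative Fv p) (at 0)"
    and Fuv: "\<And>p. p \<in> U \<Longrightarrow> ((\<lambda>t. Fu (p + s t v)) has_field_derivative Fuv p) (at 0)"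
    and Fvu: "\<And>p. p \<in> U \<Longrightarrow> ((\<lambda>t. Fv (p + s t u)) has_field_derivative Fvu p) (at 0)"
    and cont: "Ck_on 0 s V U Fuv" "Ck_on 0 s V U Fvu" and p: "p \<in> U" and uv: "u \<in> V" "v \<in> V"
  shows "Fuv p = Fvu p"
proof (rule euclidean_eqI)
  fix i :: 'k
  obtain e where e: "e > 0" "\<And>a b. norm a < e \<Longrightarrow> norm b < e \<Longrightarrow> p + s a u + s b v \<in> U"
    using plane_neighbourhood[OF p uv] by blast
  let ?P = "\<lambda>a b. p + s (of_real a) u + s (of_real b) v"
  have P: "?P a b \<in> U" if "\<bar>a\<bar> < e" "\<bar>b\<bar> < e" for a b using e(2) that by simp
  have b: "((\<lambda>b. G (?P a b) \<bullet> i) has_real_derivative D \<bullet> i) (at b)"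
    if "((\<lambda>t. G (?P a b + s t v)) has_field_derivative D) (at 0)" for G D a b
    by (rule field_derivative_real_component[OF derivative_along_line[OF that]])
  have a: "((\<lambda>a. G (?P a b) \<bullet> i) has_real_derivative D \<bullet> i) (at a)"
    if "((\<lambda>t. G (?P a b + s t u)) has_field_derivative D) (at 0)" for G D a b
  proof -
    have eq: "?P a b = p + s (of_real b) v + s (of_real a) u" for a b by (simp add: add_ac)
    show ?thesis using that unfolding eq
      by (rule field_derivative_real_component[OF derivative_along_line])
  qed
  have c: "isCont (\<lambda>z. G (?P (fst z) (snd z)) \<bullet> i) (0, 0)" if "Ck_on 0 s V U G" for G
  proof -
    have r: "isCont (\<lambda>z::real \<times> real. (of_real (fst z), of_real (snd z)) :: 'k \<times> 'k) (0, 0)"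
      by (intro continuous_intros)
    have "isCont (\<lambda>z. G (p + s (fst z) u + s (snd z) v)) (of_real (fst (0::real,0::real)), of_real (snd (0::real,0::real)))"
      using isCont_plane[OF that p uv] by simp
    from isCont_o2[OF r this] show ?thesis by (intro continuous_intros) simp
  qed
  have "Fuv (?P 0 0) \<bullet> i = Fvu (?P 0 0) \<bullet> i"
    by (rule mixed_partials_real[OF e(1), where f = "\<lambda>a b. F (?P a b) \<bullet> i" and
        fa = "\<lambda>a b. Fu (?P a b) \<bullet> i" and fb = "\<lambda>a b. Fv (?P a b) \<bullet> i" and
        fab = "\<lambda>a b. Fuv (?P a b) \<bullet> i" and fba = "\<lambda>a b. Fvu (?P a b) \<bullet> i"])
      (intro a b c P Fu Fv Fuv Fvu cont; assumption)+
  then show "Fuv p \<bullet> i = Fvu p \<bullet> i" by simp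
qed

end

text \<open>The curves are differentiable only when paired with functionals. Expanding the first
  argument in a basis reduces the claim to the product rule for finitely many scalar
  products.\<close>

lemma (in fd_type) has_field_derivative_bilinear:
  assumes \<beta>: "\<And>x. \<beta> x \<in> gd" "\<And>y. (\<lambda>x. \<beta> x y) \<in> gd"
    and u: "\<And>f. f \<in> gd \<Longrightarrow> ((\<lambda>t. f (u t)) has_field_derivative f u') (at t)"
    and v: "\<And>f. f \<in> gd \<Longrightarrow> ((\<lambda>t. f (v t)) has_field_derivative f v') (at t)"
  shows "((\<lambda>t. \<beta> (u t) (v t)) has_field_derivative \<beta> u' (v t) + \<beta> (u t) v') (at t)"
proof -
  obtain B \<delta> where B: "finite B" "\<And>b. b \<in> B \<Longrightarrow> \<delta> b \<in> gd" "\<And>x. x = (\<Sum>b\<in>B. s (\<delta> b x) b)"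
    using dual_basis_exists by metis
  have exp: "\<beta> x y = (\<Sum>b\<in>B. \<delta> b x * \<beta> b y)" for x y
  proof -
    have "\<beta> x y = \<beta> (\<Sum>b\<in>B. s (\<delta> b x) b) y"
      using arg_cong[OF B(3)[of x], of "\<lambda>x. \<beta> x y"] .
    also have "\<dots> = (\<Sum>b\<in>B. \<delta> b x * \<beta> b y)"
      by (simp only: gd_sum[OF \<beta>(2)] gd_simps(2)[OF \<beta>(2)])
    finally show ?thesis .
  qed
  have "((\<lambda>t. \<Sum>b\<in>B. \<delta> b (u t) * \<beta> b (v t)) has_field_derivative
      (\<Sum>b\<in>B. \<delta> b u' * \<beta> b (v t) + \<beta> b v' * \<delta> b (u t))) (at t)"
    by (rule DERIV_sum, rule DERIV_mult[OF u[OF B(2)] v[OF \<beta>(1)]])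
  also have "(\<lambda>t. \<Sum>b\<in>B. \<delta> b (u t) * \<beta> b (v t)) = (\<lambda>t. \<beta> (u t) (v t))"
    by (simp flip: exp)
  also have "(\<Sum>b\<in>B. \<delta> b u' * \<beta> b (v t) + \<beta> b v' * \<delta> b (u t)) = \<beta> u' (v t) + \<beta> (u t) v'"
    unfolding exp[of u' "v t"] exp[of "u t" v'] by (simp add: sum.distrib mult.commute)
  finally show ?thesis .
qed

text \<open>A derivative at 0 depends on the germ only, and short segments from a point of the open
  set \<open>U\<close> stay in \<open>U\<close>. So the derivatives \<open>F'\<close> of
  \<open>F\<close> serve for \<open>G\<close> as well, and a case distinction replaces induction on
  \<open>k\<close>.\<close>

lemma (in open_in_space) Ck_on_cong:
  assumes F: "Ck_on k s V U F" and eq: "\<And>p. p \<in> U \<Longrightarrow> F p = G p"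
  shows "Ck_on k s V U G"
proof (cases k)
  case 0
  have "continuous_map (subtopology (fd_top s V) U) euclidean G"
    by (rule continuous_map_eq[OF F[unfolded 0 Ck_on.simps]]) (simp add: eq)
  then show ?thesis unfolding 0 Ck_on.simps .
next
  case (Suc k')
  have G: "((\<lambda>t. G (p + s t v)) has_field_derivative D) (at 0)"
    if D: "((\<lambda>t. F (p + s t v)) has_field_derivative D) (at 0)" and pv: "p \<in> U" "v \<in> V" for D p v
  proof -
    have ev: "\<forall>\<^sub>F t in nhds 0. F (p + s t v) = G (p + s t v)"
      using eventually_line[OF pv] by eventually_elim (rule eq)
    show ?thesis using DERIV_cong_ev[OF refl ev refl] D by (rule iffD1)
  qed
  obtain F' where F': "\<forall>v\<in>V. (\<forall>p\<in>U. ((\<lambda>t. F (p + s t v)) has_field_derivative F' v p) (at 0)) \<and> Ck_on k' s V U (F' v)"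
    using F[unfolded Suc Ck_on.simps] by (rule exE)
  show ?thesis unfolding Suc Ck_on.simps
    by (intro exI[of _ F'] ballI conjI) (use F' G in \<open>simp_all\<close>)
qed

section \<open>Differentials of smooth maps on an open subset of the dual of a subspace\<close>

locale dual_open_set = fd_type s
  for s :: "'k::{real_normed_field,euclidean_space} \<Rightarrow> 'g::ab_group_add \<Rightarrow> 'g" +
  fixes W :: "'g set" and U :: "('g \<Rightarrow> 'k) set"
  assumes subspace_W: "subspace W" and U_open: "openin (fd_top dscale (dual s W)) U"
begin

sublocale opn: open_in_space dscale "dual s W" U
  by (rule open_in_space.intro[OF vector_space_dscale subspace_dual U_open])

abbreviation "Diff H p v \<equiv> dderiv dscale s UNIV H p v"

abbreviation "smooth H \<equiv> smooth_map dscale (dual s W) s UNIV U H"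

lemma Ck_on_smooth: "smooth H \<Longrightarrow> f \<in> gd \<Longrightarrow> Ck_on k dscale (dual s W) U (\<lambda>p. f (H p))"
  by (simp add: smooth_map_def)

lemma dderiv_unique:
  assumes "\<And>f. f \<in> gd \<Longrightarrow> ((\<lambda>t. f (H (p + dscale t v))) has_field_derivative f w) (at 0)"
  shows "Diff H p v = w"
  unfolding dderiv_def
proof (rule the_equality)
  show "has_dderiv dscale s UNIV H p v w" using assms by (simp add: has_dderiv_def)
  show "w' = w" if "has_dderiv dscale s UNIV H p v w'" for w'
    using that assms DERIV_unique by (intro separating) (fastforce simp: has_dderiv_def)
qed

text \<open>Smoothness gives one scalar derivative for each functional \<open>f\<close>. By
  uniqueness of derivatives these depend linearly on \<open>f\<close>, so reflexivity supplies a
  single vector having all of them as values.\<close>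

lemma dderiv:
  assumes H: "smooth H" and p: "p \<in> U" and v: "v \<in> dual s W" and f: "f \<in> gd"
  shows "((\<lambda>t. f (H (p + dscale t v))) has_field_derivative f (Diff H p v)) (at 0)"
proof -
  have "\<exists>D. ((\<lambda>t. f (H (p + dscale t v))) has_field_derivative D) (at 0)" if "f \<in> gd" for f
    using Ck_on_smooth[OF H that, of "Suc 0"] p v unfolding Ck_on.simps(2) by blast
  then obtain F where F: "\<And>f. f \<in> gd \<Longrightarrow> ((\<lambda>t. f (H (p + dscale t v))) has_field_derivative F f) (at 0)"
    by metis
  have "linear_map dscale gd (*) UNIV F"
  proof (rule linear_mapI)
    fix f g assume fg: "f \<in> gd" "g \<in> gd"
    have "((\<lambda>t. (f + g) (H (p + dscale t v))) has_field_derivative F f + F g) (at 0)"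
      using DERIV_add[OF F[OF fg(1)] F[OF fg(2)]] by simp
    then show "F (f + g) = F f + F g" using F[of "f + g"] fg DERIV_unique by blast
  next
    fix f c assume f: "f \<in> gd"
    have "((\<lambda>t. (dscale c f) (H (p + dscale t v))) has_field_derivative c * F f) (at 0)"
      using DERIV_cmult[OF F[OF f]] by simp
    then show "F (dscale c f) = c * F f" using F[of "dscale c f"] f DERIV_unique by blast
  qed auto
  then obtain w where "\<And>f. f \<in> gd \<Longrightarrow> f w = F f" using bidual by blast
  then have w: "((\<lambda>t. f (H (p + dscale t v))) has_field_derivative f w) (at 0)" if "f \<in> gd" for f
    using F that by simp
  then show ?thesis using dderiv_unique f by metis
qed

text \<open>The derivative hidden behind the existential quantifier of \<open>Ck_on\<close> agrees
  on \<open>U\<close> with the pairing against \<open>Diff\<close>, so its regularity carries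
  over.\<close>

lemma Ck_on_dderiv:
  assumes H: "smooth H" and v: "v \<in> dual s W" and f: "f \<in> gd"
  shows "Ck_on k dscale (dual s W) U (\<lambda>p. f (Diff H p v))"
proof -
  obtain F' where F': "\<And>p. p \<in> U \<Longrightarrow> ((\<lambda>t. f (H (p + dscale t v))) has_field_derivative F' v p) (at 0)"
    "Ck_on k dscale (dual s W) U (F' v)"
    using Ck_on_smooth[OF H f, of "Suc k"] v unfolding Ck_on.simps by blast
  show ?thesis
    by (rule opn.Ck_on_cong[OF F'(2)]) (rule DERIV_unique[OF F'(1) dderiv[OF H _ v f]])
qed

text \<open>Additivity in \<open>v\<close> rests on the continuity of the derivative. Linearity is
  what later permits representing the differential by an element of \<open>W\<close>.\<close>

lemma linear_map_dderiv:
  assumes H: "smooth H" and p: "p \<in> U" and f: "f \<in> gd"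
  shows "linear_map dscale (dual s W) (*) UNIV (\<lambda>v. f (Diff H p v))"
proof (rule linear_mapI)
  fix u v assume uv: "u \<in> dual s W" "v \<in> dual s W"
  have "((\<lambda>t. f (H (p + dscale t (u + v)))) has_field_derivative f (Diff H p u) + f (Diff H p v)) (at 0)"
    by (rule opn.directional_derivative_add[where F = "\<lambda>p. f (H p)",
          OF dderiv[OF H _ uv(1) f] dderiv[OF H _ uv(2) f] Ck_on_dderiv[OF H uv(2) f] p uv])
  then show "f (Diff H p (u + v)) = f (Diff H p u) + f (Diff H p v)"
    using dderiv[OF H p _ f, of "u + v"] uv DERIV_unique by blast
next
  fix c v assume v: "v \<in> dual s W"
  have "((\<lambda>t. f (H (p + dscale t (dscale c v)))) has_field_derivative c * f (Diff H p v)) (at 0)"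
    by (rule opn.directional_derivative_scale[where F = "\<lambda>p. f (H p)", OF dderiv[OF H p v f]])
  then show "f (Diff H p (dscale c v)) = c * f (Diff H p v)"
    using dderiv[OF H p _ f, of "dscale c v"] v DERIV_unique by blast
qed simp

lemma second_derivative_exists:
  assumes H: "smooth H" and p: "p \<in> U" and f: "f \<in> gd"
  obtains S where
    "\<And>v w. v \<in> dual s W \<Longrightarrow> w \<in> dual s W \<Longrightarrow> ((\<lambda>t. f (Diff H (p + dscale t w) v)) has_field_derivative S v w) (at 0)"
    "\<And>v w. v \<in> dual s W \<Longrightarrow> w \<in> dual s W \<Longrightarrow> S v w = S w v"
proof -
  \<comment> \<open>The second derivatives are chosen on all of \<open>U\<close> at once, because
    the symmetry argument needs their existence near \<open>p\<close> and their continuity.\<close>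
  have ex: "\<forall>v\<in>dual s W. \<exists>S. \<forall>w\<in>dual s W.
      (\<forall>p\<in>U. ((\<lambda>t. f (Diff H (p + dscale t w) v)) has_field_derivative S w p) (at 0)) \<and>
      Ck_on 0 dscale (dual s W) U (S w)"
    using Ck_on_dderiv[OF H _ f, of _ "Suc 0"] by (simp only: Ck_on.simps(2)) simp
  obtain S where S0: "\<forall>v\<in>dual s W. \<forall>w\<in>dual s W.
      (\<forall>p\<in>U. ((\<lambda>t. f (Diff H (p + dscale t w) v)) has_field_derivative S v w p) (at 0)) \<and>
      Ck_on 0 dscale (dual s W) U (S v w)"
    using bchoice[OF ex] by (rule exE)
  have S1: "((\<lambda>t. f (Diff H (p + dscale t w) v)) has_field_derivative S v w p) (at 0)"
    if "v \<in> dual s W" "w \<in> dual s W" "p \<in> U" for v w p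
    using S0[THEN bspec, OF that(1), THEN bspec, OF that(2)] that(3) by simp
  have S2: "Ck_on 0 dscale (dual s W) U (S v w)" if "v \<in> dual s W" "w \<in> dual s W" for v w
    using S0[THEN bspec, OF that(1), THEN bspec, OF that(2)] by (rule conjunct2)
  have "S v w p = S w v p" if vw: "v \<in> dual s W" "w \<in> dual s W" for v w
    by (rule opn.mixed_directional_derivatives[where F = "\<lambda>p. f (H p)" and u = v and v = w,
          OF dderiv[OF H _ vw(1) f] dderiv[OF H _ vw(2) f] S1[OF vw] S1[OF vw(2,1)]
            S2[OF vw] S2[OF vw(2,1)] p vw])
  then show thesis using S1[OF _ _ p] by (intro that[of "\<lambda>v w. S v w p"])
qed

end

section \<open>Doubles\<close>

lemma antisym_mapsD:
  assumes "t \<in> antisym_maps s"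
  shows "linear_map dscale (dual s UNIV) s UNIV t"
    and "\<xi> \<in> dual s UNIV \<Longrightarrow> \<eta> \<in> dual s UNIV \<Longrightarrow> \<eta> (t \<xi>) = - \<xi> (t \<eta>)"
  using assms by (auto simp: antisym_maps_def)

text \<open>No Jacobi identity is assumed for the double, so the locale can be instantiated both
  with the original and with the twisted data.\<close>

locale proto_double = fd_type s
  for s :: "'k::{real_normed_field,euclidean_space} \<Rightarrow> 'g::ab_group_add \<Rightarrow> 'g" +
  fixes br :: "'g \<Rightarrow> 'g \<Rightarrow> 'g" and \<omega> :: "'g \<Rightarrow> ('g \<Rightarrow> 'k) \<Rightarrow> 'g"
    and \<phi> :: "('g \<Rightarrow> 'k) \<Rightarrow> ('g \<Rightarrow> 'k) \<Rightarrow> ('g \<Rightarrow> 'k) \<Rightarrow> 'k"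
  assumes lie: "lie_algebra s UNIV br" and cocycle: "cocycle s br \<omega>" and wedge3: "\<phi> \<in> wedge3 s"
begin

lemma br_add: "br (x + y) z = br x z + br y z" "br x (y + z) = br x y + br x z"
  and br_scale: "br (s c x) y = s c (br x y)" "br x (s c y) = s c (br x y)"
  and br_self: "br x x = 0"
  and jacobi: "br x (br y z) + br y (br z x) + br z (br x y) = 0"
  using lie by (auto simp: lie_algebra_def linear_map_def)

lemma br_swap: "br y x = - br x y"
  using br_self[of "x + y"] by (simp add: br_add br_self[of x] br_self[of y] add_eq_0_iff)

lemma br_zero [simp]: "br 0 x = 0" "br x 0 = 0"
  using br_add(1)[of 0 0 x] br_add(2)[of x 0 0] by simp_all

lemma br_minus: "br (- x) y = - br x y" "br x (- y) = - br x y"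
  using br_add(1)[of x "- x" y] br_add(2)[of x y "- y"]
  by (simp_all add: eq_neg_iff_add_eq_0 add.commute)

abbreviation "ad' \<equiv> coad br UNIV"

lemma coad_apply [simp]: "ad' x f y = f (br x y)"
  by (simp add: coad_def)

lemma coad_in_dual [simp, intro]: "f \<in> gd \<Longrightarrow> ad' x f \<in> gd"
  by (auto intro!: dual_UNIV_I simp: br_add br_scale gd_simps)

lemma coad_add: "f \<in> gd \<Longrightarrow> g \<in> gd \<Longrightarrow> ad' x (f + g) = ad' x f + ad' x g"
    "f \<in> gd \<Longrightarrow> ad' (x + y) f = ad' x f + ad' y f"
  and coad_scale: "ad' x (dscale c f) = dscale c (ad' x f)"
    "f \<in> gd \<Longrightarrow> ad' (s c x) f = dscale c (ad' x f)"
  and coad_zero: "ad' x 0 = 0" "f \<in> gd \<Longrightarrow> ad' 0 f = 0"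
  by (auto simp: fun_eq_iff br_add br_scale gd_simps)

lemma \<omega>_antisym_maps: "\<omega> x \<in> antisym_maps s"
  using cocycle by (simp add: cocycle_def)

lemma \<omega>_add: "\<xi> \<in> gd \<Longrightarrow> \<eta> \<in> gd \<Longrightarrow> \<omega> x (\<xi> + \<eta>) = \<omega> x \<xi> + \<omega> x \<eta>"
    "\<xi> \<in> gd \<Longrightarrow> \<omega> (x + y) \<xi> = \<omega> x \<xi> + \<omega> y \<xi>"
  and \<omega>_scale: "\<xi> \<in> gd \<Longrightarrow> \<omega> x (dscale c \<xi>) = s c (\<omega> x \<xi>)"
    "\<xi> \<in> gd \<Longrightarrow> \<omega> (s c x) \<xi> = s c (\<omega> x \<xi>)"
  using \<omega>_antisym_maps[of x, THEN antisym_mapsD(1)] cocycle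
  by (auto simp: linear_map_def cocycle_def)

lemma \<omega>_swap: "\<xi> \<in> gd \<Longrightarrow> \<eta> \<in> gd \<Longrightarrow> \<eta> (\<omega> x \<xi>) = - \<xi> (\<omega> x \<eta>)"
  by (rule antisym_mapsD(2)[OF \<omega>_antisym_maps])

lemma \<omega>_zero: "\<omega> x 0 = 0" "\<xi> \<in> gd \<Longrightarrow> \<omega> 0 \<xi> = 0"
  using \<omega>_add(1)[of 0 0 x] \<omega>_add(2)[of \<xi> 0 0] by auto

lemma \<omega>_br: "\<xi> \<in> gd \<Longrightarrow>
    \<omega> (br x y) \<xi> = br x (\<omega> y \<xi>) + \<omega> y (ad' x \<xi>) - br y (\<omega> x \<xi>) - \<omega> x (ad' y \<xi>)"
  using cocycle by (simp add: cocycle_def)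

lemma \<omega>_slice_in_dual [simp, intro]: "\<xi> \<in> gd \<Longrightarrow> \<eta> \<in> gd \<Longrightarrow> (\<lambda>v. \<eta> (\<omega> v \<xi>)) \<in> gd"
  by (auto intro!: dual_UNIV_I simp: \<omega>_add \<omega>_scale gd_simps)

lemma \<phi>_linear:
  assumes "\<xi> \<in> gd" "\<eta> \<in> gd"
  shows "linear_map dscale gd (*) UNIV (\<lambda>\<zeta>. \<phi> \<zeta> \<xi> \<eta>)"
    and "linear_map dscale gd (*) UNIV (\<lambda>\<zeta>. \<phi> \<xi> \<zeta> \<eta>)"
    and "linear_map dscale gd (*) UNIV (\<phi> \<xi> \<eta>)"
  using wedge3 assms by (auto simp: wedge3_def)

lemma \<phi>_add:
  assumes "\<xi> \<in> gd" "\<eta> \<in> gd" "\<zeta> \<in> gd" "\<tau> \<in> gd"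
  shows "\<phi> (\<xi> + \<eta>) \<zeta> \<tau> = \<phi> \<xi> \<zeta> \<tau> + \<phi> \<eta> \<zeta> \<tau>"
    and "\<phi> \<zeta> (\<xi> + \<eta>) \<tau> = \<phi> \<zeta> \<xi> \<tau> + \<phi> \<zeta> \<eta> \<tau>"
    and "\<phi> \<zeta> \<tau> (\<xi> + \<eta>) = \<phi> \<zeta> \<tau> \<xi> + \<phi> \<zeta> \<tau> \<eta>"
  using \<phi>_linear[OF assms(3,4)] assms(1,2) by (auto simp: linear_map_def)

lemma \<phi>_scale:
  assumes "\<xi> \<in> gd" "\<zeta> \<in> gd" "\<tau> \<in> gd"
  shows "\<phi> (dscale c \<xi>) \<zeta> \<tau> = c * \<phi> \<xi> \<zeta> \<tau>"
    and "\<phi> \<zeta> (dscale c \<xi>) \<tau> = c * \<phi> \<zeta> \<xi> \<tau>"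
    and "\<phi> \<zeta> \<tau> (dscale c \<xi>) = c * \<phi> \<zeta> \<tau> \<xi>"
  using \<phi>_linear[OF assms(2,3)] assms(1) by (auto simp: linear_map_def)

lemma \<phi>_zero:
  assumes "\<zeta> \<in> gd" "\<tau> \<in> gd"
  shows "\<phi> 0 \<zeta> \<tau> = 0" "\<phi> \<zeta> 0 \<tau> = 0" "\<phi> \<zeta> \<tau> 0 = 0"
  using \<phi>_add[of 0 0 \<zeta> \<tau>] assms dual_closed(1)[of s UNIV] by simp_all

lemma \<phi>_minus:
  assumes "\<xi> \<in> gd" "\<zeta> \<in> gd" "\<tau> \<in> gd"
  shows "\<phi> (- \<xi>) \<zeta> \<tau> = - \<phi> \<xi> \<zeta> \<tau>" "\<phi> \<zeta> (- \<xi>) \<tau> = - \<phi> \<zeta> \<xi> \<tau>" "\<phi> \<zeta> \<tau> (- \<xi>) = - \<phi> \<zeta> \<tau> \<xi>"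
  using \<phi>_add[of \<xi> "- \<xi>" \<zeta> \<tau>] assms dual_closed(4)[of \<xi> s UNIV] \<phi>_zero[OF assms(2,3)]
  by (simp_all add: eq_neg_iff_add_eq_0 add.commute)

lemma \<phi>_swap:
  assumes "\<xi> \<in> gd" "\<eta> \<in> gd" "\<zeta> \<in> gd"
  shows "\<phi> \<eta> \<xi> \<zeta> = - \<phi> \<xi> \<eta> \<zeta>" "\<phi> \<xi> \<zeta> \<eta> = - \<phi> \<xi> \<eta> \<zeta>" "\<phi> \<zeta> \<eta> \<xi> = - \<phi> \<xi> \<eta> \<zeta>"
proof -
  have alt: "\<phi> \<xi> \<xi> \<eta> = 0" "\<phi> \<xi> \<eta> \<xi> = 0" "\<phi> \<eta> \<xi> \<xi> = 0" if "\<xi> \<in> gd" "\<eta> \<in> gd" for \<xi> \<eta>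
    using wedge3 that by (auto simp: wedge3_def)
  have a: "\<xi> + \<eta> \<in> gd" "\<eta> + \<zeta> \<in> gd" "\<xi> + \<zeta> \<in> gd" using assms by auto
  show "\<phi> \<eta> \<xi> \<zeta> = - \<phi> \<xi> \<eta> \<zeta>"
    using alt(1)[OF a(1) assms(3)] assms by (simp add: \<phi>_add a alt(1)[of \<xi>] alt(1)[of \<eta>] add_eq_0_iff)
  show "\<phi> \<xi> \<zeta> \<eta> = - \<phi> \<xi> \<eta> \<zeta>"
    using alt(3)[OF a(2) assms(1)] assms by (simp add: \<phi>_add a alt(3)[of \<zeta>] alt(3)[of \<eta>] add_eq_0_iff)
  show "\<phi> \<zeta> \<eta> \<xi> = - \<phi> \<xi> \<eta> \<zeta>"
    using alt(2)[OF a(3) assms(2)] assms by (simp add: \<phi>_add a alt(2)[of \<zeta>] alt(2)[of \<xi>] add_eq_0_iff)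
qed

abbreviation "C \<equiv> double_carrier s"
abbreviation "D \<equiv> double_bracket s br \<omega> \<phi>"

lemma zero_in_gd [simp]: "0 \<in> gd" by auto

lemma C_closed:
  "(x, f) \<in> C \<longleftrightarrow> f \<in> gd"
  "a \<in> C \<Longrightarrow> b \<in> C \<Longrightarrow> a + b \<in> C"
  "a \<in> C \<Longrightarrow> b \<in> C \<Longrightarrow> a - b \<in> C"
  "a \<in> C \<Longrightarrow> - a \<in> C"
  "a \<in> C \<Longrightarrow> pscale s dscale c a \<in> C"
  by (auto simp: pscale_def)

lemma form_pair: "double_form (x, \<xi>) (y, \<eta>) = \<xi> y + \<eta> x"
  by (simp add: double_form_def)

lemma form_sym: "double_form a b = double_form b a"
  by (simp add: double_form_def split_beta' add.commute)

lemma form_linear: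
  assumes "e \<in> C"
  shows "a \<in> C \<Longrightarrow> b \<in> C \<Longrightarrow> double_form (a + b) e = double_form a e + double_form b e"
    and "a \<in> C \<Longrightarrow> b \<in> C \<Longrightarrow> double_form e (a + b) = double_form e a + double_form e b"
    and "a \<in> C \<Longrightarrow> double_form (- a) e = - double_form a e"
    and "a \<in> C \<Longrightarrow> double_form e (- a) = - double_form e a"
    and "a \<in> C \<Longrightarrow> double_form (pscale s dscale c a) e = c * double_form a e"
    and "double_form 0 e = 0"
  using assms by (auto simp: double_form_def gd_simps pscale_def algebra_simps zero_prod_def)

lemma form_nondegenerate:
  assumes "a \<in> C" "b \<in> C" "\<And>e. e \<in> C \<Longrightarrow> double_form a e = double_form b e"
  shows "a = b"
proof -
  obtain x \<xi> y \<eta> where ab: "a = (x, \<xi>)" "b = (y, \<eta>)" by fastforce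
  have "x = y"
    by (rule separating) (use assms(3)[of "(0, _)"] assms(1,2) in \<open>auto simp: ab form_pair gd_simps\<close>)
  moreover have "\<xi> = \<eta>"
    using assms(3)[of "(_, 0)"] by (auto simp: ab form_pair)
  ultimately show ?thesis by (simp add: ab)
qed

lemma bracket_closed: "a \<in> C \<Longrightarrow> b \<in> C \<Longrightarrow> D a b \<in> C"
  by (auto simp: double_bracket_def intro!: dual_closed)

text \<open>Pairing with a third element turns the bracket into an explicit trilinear scalar
  expression free of \<open>vec_of\<close>. Antisymmetry, invariance and the effect of a twist are
  read off from it.\<close>

lemma form_bracket:
  assumes "\<xi> \<in> gd" "\<eta> \<in> gd" "\<zeta> \<in> gd"
  shows "double_form (D (x, \<xi>) (y, \<eta>)) (z, \<zeta>) =
    \<zeta> (br x y) + \<zeta> (\<omega> x \<eta>) - \<zeta> (\<omega> y \<xi>) + \<phi> \<xi> \<eta> \<zeta> - \<eta> (br x z) + \<xi> (br y z) + \<eta> (\<omega> z \<xi>)"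
  using assms vec_of_apply[OF \<phi>_linear(3)[OF assms(1,2)] assms(3)]
  by (simp add: double_bracket_def form_pair gd_simps algebra_simps)

text \<open>The second part is invariance of the form. Both parts come from antisymmetry of
  \<open>br\<close>, of each \<open>\<omega> x\<close> and of \<open>\<phi>\<close>, the seven terms
  being permuted among themselves.\<close>

lemma form_bracket_swap_pairs:
  assumes g: "\<xi> \<in> gd" "\<eta> \<in> gd" "\<zeta> \<in> gd"
  shows "double_form (D (y, \<eta>) (x, \<xi>)) (z, \<zeta>) = - double_form (D (x, \<xi>) (y, \<eta>)) (z, \<zeta>)" (is ?A)
    and "double_form (D (x, \<xi>) (z, \<zeta>)) (y, \<eta>) = - double_form (D (x, \<xi>) (y, \<eta>)) (z, \<zeta>)" (is ?B)
proof -
  have s: "\<zeta> (br y x) = - \<zeta> (br x y)" "\<xi> (br z y) = - \<xi> (br y z)"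
    using br_swap[of y x] br_swap[of z y] gd_simps(4)[OF g(1)] gd_simps(4)[OF g(3)] by metis+
  have w: "\<eta> (\<omega> x \<zeta>) = - \<zeta> (\<omega> x \<eta>)" "\<zeta> (\<omega> y \<xi>) = - \<xi> (\<omega> y \<zeta>)" "\<eta> (\<omega> z \<xi>) = - \<xi> (\<omega> z \<eta>)"
    using \<omega>_swap g by blast+
  show ?A
    unfolding form_bracket[OF g] form_bracket[OF g(2,1,3)] \<phi>_swap(1)[OF g] s(1) w(3) by simp
  show ?B
    unfolding form_bracket[OF g] form_bracket[OF g(1,3,2)] \<phi>_swap(2)[OF g] s(2) w by simp
qed

lemma form_bracket_swap:
  assumes "a \<in> C" "b \<in> C" "c \<in> C"
  shows "double_form (D b a) c = - double_form (D a b) c"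
    and "double_form (D a c) b = - double_form (D a b) c"
proof -
  have g: "snd a \<in> gd" "snd b \<in> gd" "snd c \<in> gd" using assms by (auto simp: mem_Times_iff)
  show "double_form (D b a) c = - double_form (D a b) c"
    using form_bracket_swap_pairs(1)[OF g, where x = "fst a" and y = "fst b" and z = "fst c"] by simp
  show "double_form (D a c) b = - double_form (D a b) c"
    using form_bracket_swap_pairs(2)[OF g, where x = "fst a" and y = "fst b" and z = "fst c"] by simp
qed

lemma bracket_swap:
  assumes "a \<in> C" "b \<in> C" shows "D b a = - D a b"
proof (rule form_nondegenerate)
  fix e assume "e \<in> C"
  then show "double_form (D b a) e = double_form (- D a b) e"
    using form_bracket_swap(1)[OF assms] by (simp add: form_linear bracket_closed assms)
qed (use assms in \<open>auto intro!: bracket_closed C_closed\<close>)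

text \<open>Invariance moves the argument \<open>b + c\<close> out of the bracket into a slot of the
  form, where linearity is evident; the same device handles scalars.\<close>

lemma bracket_add_right:
  assumes "a \<in> C" "b \<in> C" "c \<in> C"
  shows "D a (b + c) = D a b + D a c"
proof (rule form_nondegenerate)
  fix e assume e: "e \<in> C"
  have "double_form (D a (b + c)) e = - double_form (D a e) (b + c)"
    using assms e form_bracket_swap(2)[of a e "b + c"] by (simp add: C_closed)
  also have "\<dots> = double_form (D a b + D a c) e"
    using assms e form_bracket_swap(2)[of a e b] form_bracket_swap(2)[of a e c]
    by (simp add: form_linear bracket_closed)
  finally show "double_form (D a (b + c)) e = double_form (D a b + D a c) e" .
qed (use assms in \<open>auto intro!: bracket_closed C_closed\<close>)

lemma bracket_scale_right:
  assumes "a \<in> C" "b \<in> C"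
  shows "D a (pscale s dscale c b) = pscale s dscale c (D a b)"
proof (rule form_nondegenerate)
  fix e assume e: "e \<in> C"
  have "double_form (D a (pscale s dscale c b)) e = - double_form (D a e) (pscale s dscale c b)"
    using assms e form_bracket_swap(2)[of a e "pscale s dscale c b"] by (simp add: C_closed)
  also have "\<dots> = - (c * double_form (D a e) b)"
    using assms e by (simp add: form_sym[of "D a e"] form_linear bracket_closed)
  also have "\<dots> = double_form (pscale s dscale c (D a b)) e"
    using assms e form_bracket_swap(2)[of a e b]
    by (simp add: form_linear bracket_closed)
  finally show "double_form (D a (pscale s dscale c b)) e = double_form (pscale s dscale c (D a b)) e" .
qed (use assms in \<open>auto intro!: bracket_closed C_closed\<close>)

lemma bracket_add_left:
  assumes "a \<in> C" "b \<in> C" "c \<in> C"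
  shows "D (a + b) c = D a c + D b c"
  unfolding bracket_swap[OF assms(3) C_closed(2)[OF assms(1,2)]] bracket_swap[OF assms(3,1)] bracket_swap[OF assms(3,2)]
    bracket_add_right[OF assms(3,1,2)] by simp

lemma bracket_scale_left:
  assumes "a \<in> C" "b \<in> C"
  shows "D (pscale s dscale c a) b = pscale s dscale c (D a b)"
proof -
  interpret p: vector_space "pscale s (dscale :: 'k \<Rightarrow> ('g \<Rightarrow> 'k) \<Rightarrow> _)" by (rule vector_space_pscale)
  show ?thesis
    unfolding bracket_swap[OF assms(2) C_closed(5)[OF assms(1)]] bracket_swap[OF assms(2,1)]
      bracket_scale_right[OF assms(2,1)] by simp
qed

text \<open>As the form is invariant, \<open>jac a b c d\<close> is up to sign the pairing of the Jacobiator of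
  \<open>a\<close>, \<open>b\<close>, \<open>c\<close> with \<open>d\<close>; in this shape it is visibly alternating in its four arguments.\<close>

definition jac :: "'g \<times> ('g \<Rightarrow> 'k) \<Rightarrow> 'g \<times> ('g \<Rightarrow> 'k) \<Rightarrow> 'g \<times> ('g \<Rightarrow> 'k) \<Rightarrow> 'g \<times> ('g \<Rightarrow> 'k) \<Rightarrow> 'k"
  where "jac a b c d = double_form (D a b) (D c d) + double_form (D b c) (D a d) + double_form (D c a) (D b d)"

lemma jac_swap:
  assumes "a \<in> C" "b \<in> C" "c \<in> C" "d \<in> C"
  shows "jac b a c d = - jac a b c d" "jac a c b d = - jac a b c d" "jac a b d c = - jac a b c d"
proof -
  note sw = bracket_swap[OF assms(1,2)] bracket_swap[OF assms(3,1)] bracket_swap[OF assms(2,3)]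
    bracket_swap[OF assms(3,4)] bracket_swap[OF assms(1,4)]
  note cl = bracket_closed form_linear assms
  show "jac b a c d = - jac a b c d" "jac a c b d = - jac a b c d"
    unfolding jac_def sw by (simp_all add: cl)
  show "jac a b d c = - jac a b c d"
    unfolding jac_def sw form_sym[of "D b d"] form_sym[of "D b c"] by (simp add: cl)
qed

lemma jac_add:
  assumes "a \<in> C" "a' \<in> C" "b \<in> C" "c \<in> C" "d \<in> C"
  shows "jac (a + a') b c d = jac a b c d + jac a' b c d"
  using assms by (simp add: jac_def bracket_add_left bracket_add_right form_linear bracket_closed C_closed algebra_simps)

lemma bracket_lie_algebra:
  assumes "\<And>a b c d. a \<in> C \<Longrightarrow> b \<in> C \<Longrightarrow> c \<in> C \<Longrightarrow> d \<in> C \<Longrightarrow> jac a b c d = 0"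
  shows "lie_algebra (pscale s dscale) C D"
proof -
  have jacobi: "D a (D b c) + D b (D c a) + D c (D a b) = 0" if abc: "a \<in> C" "b \<in> C" "c \<in> C" for a b c
  proof (rule form_nondegenerate)
    fix d assume d: "d \<in> C"
    have "double_form (D a (D b c)) d = - double_form (D b c) (D a d)" if "a \<in> C" "b \<in> C" "c \<in> C" for a b c
      using that d form_bracket_swap(2)[of a "D b c" d] form_sym[of "D a d"] by (simp add: bracket_closed)
    then have "double_form (D a (D b c) + D b (D c a) + D c (D a b)) d = - jac a b c d"
      using abc d by (simp add: form_linear bracket_closed C_closed jac_def)
    then show "double_form (D a (D b c) + D b (D c a) + D c (D a b)) d = double_form 0 d"
      using assms abc d by (simp add: form_linear)
  qed (use abc in \<open>auto intro!: bracket_closed C_closed simp: zero_prod_def\<close>)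
  \<comment> \<open>Each pairing equals its own negative, and the ground field has characteristic
    zero.\<close>
  have self: "D a a = 0" if "a \<in> C" for a
  proof (rule form_nondegenerate)
    fix e assume "e \<in> C"
    then have "double_form (D a a) e = - double_form (D a a) e" using form_bracket_swap(1)[OF that that] by blast
    then show "double_form (D a a) e = double_form 0 e" using \<open>e \<in> C\<close> by (simp add: form_linear)
  qed (use that in \<open>auto intro!: bracket_closed simp: zero_prod_def\<close>)
  show ?thesis
    unfolding lie_algebra_def
    using fd_double jacobi self
    by (auto intro!: linear_mapI bracket_closed bracket_add_left bracket_add_right
        bracket_scale_left bracket_scale_right simp del: mem_Sigma_iff split_paired_All split_paired_Ball_Sigma)
qed

end

section \<open>The Jacobi form with a vector among its arguments, and the reduction to four
  covectors\<close>

context proto_double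
begin

text \<open>With zero covector part in \<open>(x, 0)\<close>, the bracket
  \<open>D (x, 0) (w, \<xi>)\<close> loses its \<open>\<phi>\<close> term and has covector part
  \<open>- ad' x \<xi>\<close>. Three instances with permuted arguments give the whole Jacobi
  form.\<close>

lemma form_bracket_bracket:
  assumes "\<xi> \<in> gd" "\<eta> \<in> gd" "\<zeta> \<in> gd"
  shows "double_form (D (y, \<eta>) (z, \<zeta>)) (D (x, 0) (w, \<xi>)) =
    - \<xi> (br x (br y z)) - \<xi> (br x (\<omega> y \<zeta>)) + \<xi> (br x (\<omega> z \<eta>)) - \<phi> \<eta> \<zeta> (ad' x \<xi>)
    - \<zeta> (br y (br x w)) - \<zeta> (br y (\<omega> x \<xi>)) + \<eta> (br z (br x w)) + \<eta> (br z (\<omega> x \<xi>))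
    + \<zeta> (\<omega> (br x w) \<eta>) + \<zeta> (\<omega> (\<omega> x \<xi>) \<eta>)"
proof -
  have v0: "vec_of s (\<phi> 0 \<xi>) = 0"
  proof (rule separating)
    fix f assume f: "f \<in> gd"
    show "f (vec_of s (\<phi> 0 \<xi>)) = f 0"
      unfolding vec_of_apply[OF \<phi>_linear(3)[OF zero_in_gd assms(1)] f] \<phi>_zero(1)[OF assms(1) f] gd_simps(3)[OF f] ..
  qed
  have Dx: "D (x, 0) (w, \<xi>) = (br x w + \<omega> x \<xi>, - ad' x \<xi>)"
    by (simp add: double_bracket_def v0 \<omega>_zero coad_zero fun_eq_iff gd_simps(3)[OF assms(1)])
  have mem: "- ad' x \<xi> \<in> gd" using assms by auto
  show ?thesis
    unfolding Dx form_bracket[OF assms(2,3) mem] \<phi>_minus(3)[OF coad_in_dual[OF assms(1)] assms(2,3)]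
      br_add \<omega>_add(2)[OF assms(2)] gd_simps(1)[OF assms(2)] gd_simps(1)[OF assms(3)]
    by simp
qed

lemma jac_vector_eq_0:
  assumes quad: "\<And>x \<xi> \<eta> \<zeta>. \<xi> \<in> gd \<Longrightarrow> \<eta> \<in> gd \<Longrightarrow> \<zeta> \<in> gd \<Longrightarrow>
      ad3 br x \<phi> \<xi> \<eta> \<zeta> = cyc (\<lambda>\<xi> \<eta> \<zeta>. \<xi> (\<omega> (\<omega> x \<eta>) \<zeta>)) \<xi> \<eta> \<zeta>"
    and bcd: "b \<in> C" "c \<in> C" "d \<in> C"
  shows "jac (x, 0) b c d = 0"
proof -
  obtain y \<eta> where b: "b = (y, \<eta>)" by (cases b)
  obtain z \<zeta> where c: "c = (z, \<zeta>)" by (cases c)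
  obtain w \<tau> where d: "d = (w, \<tau>)" by (cases d)
  have g: "\<eta> \<in> gd" "\<zeta> \<in> gd" "\<tau> \<in> gd" using bcd by (auto simp: b c d)
  have x: "(x, 0) \<in> C" by simp
  have J: "f (br x (br y z)) + f (br z (br x y)) - f (br y (br x z)) = 0" if f: "f \<in> gd" for f x y z
  proof -
    have "f (br x (br y z) + br y (br z x) + br z (br x y)) = 0" using jacobi gd_simps(3)[OF f] by simp
    then show ?thesis
      unfolding br_swap[of z x] br_minus gd_simps[OF f] by (simp add: algebra_simps)
  qed
  \<comment> \<open>The cocycle condition paired with \<open>g\<close>, where antisymmetry of
    \<open>\<omega>\<close> has moved the coadjoint action from \<open>f\<close> onto the other
    factor as an ordinary bracket.\<close>
  have coc: "g (\<omega> (br x y) f) - g (br x (\<omega> y f)) + g (br y (\<omega> x f)) - f (br y (\<omega> x g)) + f (br x (\<omega> y g)) = 0"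
    if fg: "f \<in> gd" "g \<in> gd" for f g x y
  proof -
    have "g (\<omega> y (ad' x f)) = - f (br x (\<omega> y g))" "g (\<omega> x (ad' y f)) = - f (br y (\<omega> x g))"
      using \<omega>_swap[OF coad_in_dual[OF fg(1)] fg(2)] by auto
    then show ?thesis
      unfolding \<omega>_br[OF fg(1)] gd_simps[OF fg(2)] by simp
  qed
  have Q: "\<phi> (ad' x \<eta>) \<zeta> \<tau> + \<phi> \<eta> (ad' x \<zeta>) \<tau> + \<phi> \<eta> \<zeta> (ad' x \<tau>)
      - \<eta> (\<omega> (\<omega> x \<zeta>) \<tau>) - \<zeta> (\<omega> (\<omega> x \<tau>) \<eta>) - \<tau> (\<omega> (\<omega> x \<eta>) \<zeta>) = 0"
    using quad[OF g] by (simp add: ad3_def cyc_def algebra_simps)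
  have p1: "\<phi> \<zeta> \<tau> (ad' x \<eta>) = \<phi> (ad' x \<eta>) \<zeta> \<tau>"
    using \<phi>_swap(1)[of "ad' x \<eta>" \<zeta> \<tau>] \<phi>_swap(2)[of \<zeta> "ad' x \<eta>" \<tau>] g by simp
  have p2: "\<phi> \<eta> \<tau> (ad' x \<zeta>) = - \<phi> \<eta> (ad' x \<zeta>) \<tau>"
    using \<phi>_swap(2)[of \<eta> "ad' x \<zeta>" \<tau>] g by simp
  have p3: "\<tau> (\<omega> (\<omega> x \<zeta>) \<eta>) = - \<eta> (\<omega> (\<omega> x \<zeta>) \<tau>)"
    using \<omega>_swap g by blast
  have cl: "D c d \<in> C" "D b c \<in> C" "D b d \<in> C" "D (x, 0) b \<in> C" "D (x, 0) c \<in> C"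
    using bcd x by (blast intro: bracket_closed)+
  have "jac (x, 0) b c d = double_form (D c d) (D (x, 0) b) + double_form (D b c) (D (x, 0) d)
      - double_form (D b d) (D (x, 0) c)"
    unfolding jac_def bracket_swap[OF x bcd(2)] form_linear(3)[OF cl(3,5)]
    by (simp add: form_sym[of "D c d"] form_sym[of "D b d"])
  \<comment> \<open>Regrouping by the number of covectors involved: a Jacobi sum for each covector,
    a cocycle sum for each pair, and the hypothesis on \<open>\<phi>\<close> for the triple.\<close>
  also have "\<dots> =
      - (\<tau> (br x (br y z)) + \<tau> (br z (br x y)) - \<tau> (br y (br x z)))
      + (\<zeta> (br x (br y w)) + \<zeta> (br w (br x y)) - \<zeta> (br y (br x w)))
      - (\<eta> (br x (br z w)) + \<eta> (br w (br x z)) - \<eta> (br z (br x w)))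
      + (\<tau> (\<omega> (br x y) \<zeta>) - \<tau> (br x (\<omega> y \<zeta>)) + \<tau> (br y (\<omega> x \<zeta>)) - \<zeta> (br y (\<omega> x \<tau>)) + \<zeta> (br x (\<omega> y \<tau>)))
      + (\<zeta> (\<omega> (br x w) \<eta>) - \<zeta> (br x (\<omega> w \<eta>)) + \<zeta> (br w (\<omega> x \<eta>)) - \<eta> (br w (\<omega> x \<zeta>)) + \<eta> (br x (\<omega> w \<zeta>)))
      - (\<tau> (\<omega> (br x z) \<eta>) - \<tau> (br x (\<omega> z \<eta>)) + \<tau> (br z (\<omega> x \<eta>)) - \<eta> (br z (\<omega> x \<tau>)) + \<eta> (br x (\<omega> z \<tau>)))
      - (\<phi> (ad' x \<eta>) \<zeta> \<tau> + \<phi> \<eta> (ad' x \<zeta>) \<tau> + \<phi> \<eta> \<zeta> (ad' x \<tau>)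
      - \<eta> (\<omega> (\<omega> x \<zeta>) \<tau>) - \<zeta> (\<omega> (\<omega> x \<tau>) \<eta>) - \<tau> (\<omega> (\<omega> x \<eta>) \<zeta>))"
    unfolding b c d form_bracket_bracket[OF g] form_bracket_bracket[OF g(3,1,2)] form_bracket_bracket[OF g(2,1,3)]
      p1 p2 p3
    by (simp add: algebra_simps)
  also have "\<dots> = 0"
    unfolding J[OF g(1)] J[OF g(2)] J[OF g(3)] coc[OF g(2,3)] coc[OF g(1,2)] coc[OF g(1,3)] Q by simp
  finally show ?thesis .
qed

lemma jac_eq_0:
  assumes vec: "\<And>x b c d. b \<in> C \<Longrightarrow> c \<in> C \<Longrightarrow> d \<in> C \<Longrightarrow> jac (x, 0) b c d = 0"
    and cov: "\<And>\<xi> \<eta> \<zeta> \<tau>. \<xi> \<in> gd \<Longrightarrow> \<eta> \<in> gd \<Longrightarrow> \<zeta> \<in> gd \<Longrightarrow> \<tau> \<in> gd \<Longrightarrow>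
      jac (0, \<xi>) (0, \<eta>) (0, \<zeta>) (0, \<tau>) = 0"
    and abcd: "a \<in> C" "b \<in> C" "c \<in> C" "d \<in> C"
  shows "jac a b c d = 0"
proof -
  have red: "jac a b c d = jac (0, snd a) b c d" if "a \<in> C" "b \<in> C" "c \<in> C" "d \<in> C" for a b c d
  proof -
    have a: "a = (fst a, 0) + (0, snd a)" by simp
    have m: "(fst a, 0) \<in> C" "(0, snd a) \<in> C" using that(1) by (auto simp: mem_Times_iff)
    have "jac a b c d = jac ((fst a, 0) + (0, snd a)) b c d" using a by simp
    then show ?thesis using jac_add[OF m that(2-4)] vec[OF that(2-4)] by simp
  qed
  have m: "(0, snd a) \<in> C" "(0, snd b) \<in> C" "(0, snd c) \<in> C" "(0, snd d) \<in> C"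
    using abcd by (auto simp: mem_Times_iff)
  have "jac a b c d = jac (0, snd a) b c d" by (rule red[OF abcd])
  also have "\<dots> = - jac b (0, snd a) c d" by (rule jac_swap(1)[OF abcd(2) m(1) abcd(3,4)])
  also have "\<dots> = - jac (0, snd b) (0, snd a) c d" unfolding red[OF abcd(2) m(1) abcd(3,4)] ..
  also have "\<dots> = jac (0, snd b) c (0, snd a) d"
    unfolding jac_swap(2)[OF m(2) abcd(3) m(1) abcd(4)] by simp
  also have "\<dots> = - jac c (0, snd b) (0, snd a) d" by (rule jac_swap(1)[OF abcd(3) m(2,1) abcd(4)])
  also have "\<dots> = - jac (0, snd c) (0, snd b) (0, snd a) d" unfolding red[OF abcd(3) m(2,1) abcd(4)] ..
  also have "\<dots> = jac (0, snd c) (0, snd b) d (0, snd a)"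
    unfolding jac_swap(3)[OF m(3,2) abcd(4) m(1)] by simp
  also have "\<dots> = - jac (0, snd c) d (0, snd b) (0, snd a)" by (rule jac_swap(2)[OF m(3) abcd(4) m(2,1)])
  also have "\<dots> = jac d (0, snd c) (0, snd b) (0, snd a)" unfolding jac_swap(1)[OF abcd(4) m(3,2,1)] by simp
  also have "\<dots> = jac (0, snd d) (0, snd c) (0, snd b) (0, snd a)" by (rule red[OF abcd(4) m(3,2,1)])
  also have "\<dots> = 0" using abcd by (intro cov) (auto simp: mem_Times_iff)
  finally show ?thesis .
qed

end

section \<open>Twists\<close>

locale twist = proto_double +
  fixes t :: "('b \<Rightarrow> 'a) \<Rightarrow> 'b"
  assumes t: "t \<in> antisym_maps s"
begin

lemma t_add: "\<xi> \<in> gd \<Longrightarrow> \<eta> \<in> gd \<Longrightarrow> t (\<xi> + \<eta>) = t \<xi> + t \<eta>"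
  and t_scale: "\<xi> \<in> gd \<Longrightarrow> t (dscale c \<xi>) = s c (t \<xi>)"
  using antisym_mapsD(1)[OF t] by (auto simp: linear_map_def)

lemma t_swap: "\<xi> \<in> gd \<Longrightarrow> \<eta> \<in> gd \<Longrightarrow> \<eta> (t \<xi>) = - \<xi> (t \<eta>)"
  by (rule antisym_mapsD(2)[OF t])

lemma t_coad: "\<xi> \<in> gd \<Longrightarrow> \<eta> \<in> gd \<Longrightarrow> \<eta> (t (ad' x \<xi>)) = - \<xi> (br x (t \<eta>))"
  using t_swap[of "ad' x \<xi>" \<eta>] by simp

abbreviation "\<omega>t \<equiv> twist_cocycle br t \<omega>"
abbreviation "\<phi>t \<equiv> twist_form br t \<omega> \<phi>"

lemma twist_antisym: "\<omega>t x \<in> antisym_maps s"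
  unfolding antisym_maps_def
proof (safe intro!: linear_mapI UNIV_I)
  fix \<xi> \<eta> assume g: "\<xi> \<in> gd" "\<eta> \<in> gd"
  show "\<omega>t x (\<xi> + \<eta>) = \<omega>t x \<xi> + \<omega>t x \<eta>"
    using g by (simp add: twist_cocycle_def \<omega>_add t_add br_add coad_add algebra_simps)
  show "\<eta> (\<omega>t x \<xi>) = - \<xi> (\<omega>t x \<eta>)"
    unfolding twist_cocycle_def gd_simps[OF g(1)] gd_simps[OF g(2)] t_coad[OF g] t_coad[OF g(2,1)] \<omega>_swap[OF g]
    by simp
next
  fix c \<xi> assume g: "\<xi> \<in> gd"
  then show "\<omega>t x (dscale c \<xi>) = s c (\<omega>t x \<xi>)"
    by (simp add: twist_cocycle_def \<omega>_scale t_scale br_scale coad_scale scale_right_distrib)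
qed

text \<open>The term added by the twist is the action of \<open>x\<close> on the tensor
  \<open>t\<close>, hence a coboundary. That it satisfies the cocycle identity is the Jacobi
  identity of \<open>br\<close>, used directly and in transposed form.\<close>

lemma twist_is_cocycle: "cocycle s br \<omega>t"
  unfolding cocycle_def
proof (intro conjI allI ballI twist_antisym)
  fix \<xi> assume g: "\<xi> \<in> gd"
  show "linear_map s UNIV s UNIV (\<lambda>x. \<omega>t x \<xi>)"
    using g by (auto intro!: linear_mapI
      simp: twist_cocycle_def \<omega>_add \<omega>_scale t_add t_scale br_add br_scale coad_add coad_scale scale_right_distrib algebra_simps)
  fix x y
  have J: "br (br x y) v = br x (br y v) - br y (br x v)" for v
    using jacobi[of x y v] br_swap[of "br x y" v] br_swap[of v x]
    by (simp add: br_minus algebra_simps add_eq_0_iff)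
  have "ad' (br x y) \<xi> = ad' y (ad' x \<xi>) - ad' x (ad' y \<xi>)"
    by (simp add: fun_eq_iff J gd_simps[OF g])
  then have "t (ad' (br x y) \<xi>) + t (ad' x (ad' y \<xi>)) = t (ad' y (ad' x \<xi>))"
    using t_add[of "ad' (br x y) \<xi>" "ad' x (ad' y \<xi>)"] g by (simp add: dual_closed)
  then show "\<omega>t (br x y) \<xi> = br x (\<omega>t y \<xi>) + \<omega>t y (ad' x \<xi>) - br y (\<omega>t x \<xi>) - \<omega>t x (ad' y \<xi>)"
    unfolding twist_cocycle_def \<omega>_br[OF g] J br_add
    by (simp add: algebra_simps)
qed

text \<open>\<open>\<phi>t\<close> is invariant under rotation of its arguments, so linearity in the
  first slot and vanishing on equal first two arguments imply the rest.\<close>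

lemma twist_wedge3: "\<phi>t \<in> wedge3 s"
proof -
  let ?F = "\<lambda>\<xi> \<eta> \<zeta>. \<zeta> (br (t \<xi>) (t \<eta>) + \<omega> (t \<xi>) \<eta>)"
  have F: "\<phi>t \<xi> \<eta> \<zeta> = \<phi> \<xi> \<eta> \<zeta> + (?F \<xi> \<eta> \<zeta> + ?F \<eta> \<zeta> \<xi> + ?F \<zeta> \<xi> \<eta>)" for \<xi> \<eta> \<zeta>
    by (simp only: twist_form_def cyc_def)
  have cycl: "\<phi>t \<xi> \<eta> \<zeta> = \<phi>t \<eta> \<zeta> \<xi>" if g: "\<xi> \<in> gd" "\<eta> \<in> gd" "\<zeta> \<in> gd" for \<xi> \<eta> \<zeta>
    using \<phi>_swap(1)[OF g] \<phi>_swap(2)[OF g(2,1,3)] unfolding F by simp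
  have add: "\<phi>t (\<xi> + \<xi>') \<eta> \<zeta> = \<phi>t \<xi> \<eta> \<zeta> + \<phi>t \<xi>' \<eta> \<zeta>"
    if g: "\<xi> \<in> gd" "\<xi>' \<in> gd" "\<eta> \<in> gd" "\<zeta> \<in> gd" for \<xi> \<xi>' \<eta> \<zeta>
    unfolding F \<phi>_add(1)[OF g] t_add[OF g(1,2)] br_add \<omega>_add(1)[OF g(1,2)] \<omega>_add(2)[OF g(3)]
    using g by (simp add: gd_simps(1) algebra_simps)
  have scale: "\<phi>t (dscale c \<xi>) \<eta> \<zeta> = c * \<phi>t \<xi> \<eta> \<zeta>"
    if g: "\<xi> \<in> gd" "\<eta> \<in> gd" "\<zeta> \<in> gd" for c \<xi> \<eta> \<zeta>
    unfolding F \<phi>_scale(1)[OF g] t_scale[OF g(1)] br_scale \<omega>_scale(1)[OF g(1)] \<omega>_scale(2)[OF g(2)]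
    using g by (simp add: gd_simps(1,2) algebra_simps)
  have lin: "linear_map dscale gd (*) UNIV (\<lambda>\<xi>. \<phi>t \<xi> \<eta> \<zeta>)" if "\<eta> \<in> gd" "\<zeta> \<in> gd" for \<eta> \<zeta>
    by (rule linear_mapI) (simp_all add: add scale that)
  have alt: "\<phi>t \<xi> \<xi> \<eta> = 0" if g: "\<xi> \<in> gd" "\<eta> \<in> gd" for \<xi> \<eta>
  proof -
    have w: "\<xi> (\<omega> x \<xi>) = 0" for x
      using \<omega>_swap[OF g(1,1), of x] by simp
    have "\<phi> \<xi> \<xi> \<eta> = 0" using \<phi>_swap(1)[OF g(1,1,2)] by simp
    then show ?thesis
      unfolding F gd_simps[OF g(1)] gd_simps[OF g(2)] br_self w br_swap[of "t \<eta>" "t \<xi>"] \<omega>_swap[OF g]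
      by simp
  qed
  have lin': "linear_map dscale gd (*) UNIV f" if "linear_map dscale gd (*) UNIV h" "\<And>\<zeta>. \<zeta> \<in> gd \<Longrightarrow> f \<zeta> = h \<zeta>" for f h
    using that by (auto simp: linear_map_def dual_closed)
  show ?thesis
    unfolding wedge3_def
  proof (intro CollectI ballI conjI)
    fix \<xi> \<eta> assume g: "\<xi> \<in> gd" "\<eta> \<in> gd"
    show "linear_map dscale gd (*) UNIV (\<lambda>\<zeta>. \<phi>t \<zeta> \<xi> \<eta>)" by (rule lin[OF g])
    show "linear_map dscale gd (*) UNIV (\<lambda>\<zeta>. \<phi>t \<xi> \<zeta> \<eta>)"
      by (rule lin'[OF lin[OF g(2,1)]]) (rule cycl[OF g(1) _ g(2)])
    show "linear_map dscale gd (*) UNIV (\<lambda>\<zeta>. \<phi>t \<xi> \<eta> \<zeta>)"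
      by (rule lin'[OF lin[OF g]]) (rule cycl[symmetric, OF _ g])
    show "\<phi>t \<xi> \<xi> \<eta> = 0" by (rule alt[OF g])
    show "\<phi>t \<xi> \<eta> \<xi> = 0" using cycl[OF g(1,1,2)] alt[OF g] by simp
    show "\<phi>t \<eta> \<xi> \<xi> = 0" using cycl[OF g(2,1,1)] alt[OF g] by simp
  qed
qed

sublocale tw: proto_double s br \<omega>t \<phi>t
  by unfold_locales (rule lie twist_is_cocycle twist_wedge3)+

definition shear :: "'b \<times> ('b \<Rightarrow> 'a) \<Rightarrow> 'b \<times> ('b \<Rightarrow> 'a)"
  where "shear a = (fst a + t (snd a), snd a)"

lemma shear_closed: "a \<in> C \<Longrightarrow> shear a \<in> C"
  by (auto simp: shear_def)

lemma form_shear: "a \<in> C \<Longrightarrow> b \<in> C \<Longrightarrow> double_form (shear a) (shear b) = double_form a b"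
  using t_swap[of "snd a" "snd b"] by (auto simp: shear_def double_form_def gd_simps split_beta')

text \<open>This explains the formulas for \<open>\<omega>t\<close> and \<open>\<phi>t\<close>: they
  are the mixed and the purely covector components of the bracket pulled back along
  \<open>shear\<close>.\<close>

lemma form_twisted_bracket:
  assumes "a \<in> C" "b \<in> C" "c \<in> C"
  shows "double_form (tw.D a b) c = double_form (D (shear a) (shear b)) (shear c)"
proof -
  obtain x \<xi> where a: "a = (x, \<xi>)" by (cases a)
  obtain y \<eta> where b: "b = (y, \<eta>)" by (cases b)
  obtain z \<zeta> where c: "c = (z, \<zeta>)" by (cases c)
  have g: "\<xi> \<in> gd" "\<eta> \<in> gd" "\<zeta> \<in> gd" using assms by (auto simp: a b c)
  have e: "\<zeta> (br y (t \<xi>)) = - \<zeta> (br (t \<xi>) y)" "\<eta> (br (t \<zeta>) (t \<xi>)) = - \<eta> (br (t \<xi>) (t \<zeta>))"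
    "\<eta> (br z (t \<xi>)) = - \<eta> (br (t \<xi>) z)" "\<xi> (br z (t \<eta>)) = - \<xi> (br (t \<eta>) z)"
    using br_swap[of y "t \<xi>"] br_swap[of "t \<zeta>" "t \<xi>"] br_swap[of z "t \<xi>"] br_swap[of z "t \<eta>"]
    by (simp_all only: gd_simps(4)[OF g(1)] gd_simps(4)[OF g(2)] gd_simps(4)[OF g(3)])
  have w: "\<xi> (\<omega> (t \<eta>) \<zeta>) = - \<zeta> (\<omega> (t \<eta>) \<xi>)" by (rule \<omega>_swap[OF g(3,1)])
  show ?thesis
    unfolding a b c shear_def fst_conv snd_conv form_bracket[OF g] tw.form_bracket[OF g]
      twist_form_def cyc_def twist_cocycle_def br_add gd_simps(1)[OF g(1)] gd_simps(1)[OF g(2)] gd_simps(1)[OF g(3)]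
      \<omega>_add(2)[OF g(1)] \<omega>_add(2)[OF g(2)] t_coad[OF g(2,3)] t_coad[OF g(1,3)] t_coad[OF g(1,2)] e w
    by simp
qed

lemma shear_twisted_bracket:
  assumes "a \<in> C" "b \<in> C"
  shows "shear (tw.D a b) = D (shear a) (shear b)"
proof (rule form_nondegenerate)
  fix e assume e: "e \<in> C"
  \<comment> \<open>The preimage of \<open>e\<close> under \<open>shear\<close>, whose inverse is
    the shear by the negative of \<open>t\<close>; so testing against sheared elements
    suffices.\<close>
  define e' where "e' = (fst e - t (snd e), snd e)"
  have e': "e' \<in> C" "shear e' = e" using e by (auto simp: e'_def shear_def)
  have "double_form (shear (tw.D a b)) (shear e') = double_form (tw.D a b) e'"
    by (rule form_shear[OF tw.bracket_closed[OF assms] e'(1)])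
  also have "\<dots> = double_form (D (shear a) (shear b)) (shear e')"
    by (rule form_twisted_bracket[OF assms e'(1)])
  finally show "double_form (shear (tw.D a b)) e = double_form (D (shear a) (shear b)) e"
    unfolding e'(2) .
qed (use assms in \<open>blast intro: shear_closed bracket_closed tw.bracket_closed\<close>)+

lemma twisted_jac:
  assumes "a \<in> C" "b \<in> C" "c \<in> C" "d \<in> C"
  shows "tw.jac a b c d = jac (shear a) (shear b) (shear c) (shear d)"
proof -
  have "double_form (tw.D a b) (tw.D c d) = double_form (D (shear a) (shear b)) (D (shear c) (shear d))"
    if "a \<in> C" "b \<in> C" "c \<in> C" "d \<in> C" for a b c d
    using form_twisted_bracket[OF that(1,2) tw.bracket_closed[OF that(3,4)]] shear_twisted_bracket[OF that(3,4)]
    by simp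
  then show ?thesis using assms by (simp add: jac_def tw.jac_def)
qed

lemma twisted_jac_vector_eq_0:
  assumes "\<And>x \<xi> \<eta> \<zeta>. \<xi> \<in> gd \<Longrightarrow> \<eta> \<in> gd \<Longrightarrow> \<zeta> \<in> gd \<Longrightarrow>
      ad3 br x \<phi> \<xi> \<eta> \<zeta> = cyc (\<lambda>\<xi> \<eta> \<zeta>. \<xi> (\<omega> (\<omega> x \<eta>) \<zeta>)) \<xi> \<eta> \<zeta>"
    and bcd: "b \<in> C" "c \<in> C" "d \<in> C"
  shows "tw.jac (x, 0) b c d = 0"
proof -
  have x: "(x, 0) \<in> C" by simp
  have "t 0 = 0" using t_add[of 0 0] by simp
  then have "shear (x, 0) = (x, 0)" by (simp add: shear_def)
  then show ?thesis
    using jac_vector_eq_0[OF assms(1) shear_closed[OF bcd(1)] shear_closed[OF bcd(2)] shear_closed[OF bcd(3)]]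
      twisted_jac[OF x bcd] by simp
qed

end

section \<open>Passing to a subspace, and the star bracket as a twisted double bracket\<close>

lemma lie_algebra_restrict:
  assumes V: "lie_algebra s V br" and W: "lie_subalgebra s V br W"
    and eq: "\<And>a b. a \<in> W \<Longrightarrow> b \<in> W \<Longrightarrow> br' a b = br a b"
  shows "lie_algebra s W br'"
proof -
  have sub: "module.subspace s W" "W \<subseteq> V" and cl: "\<And>a b. a \<in> W \<Longrightarrow> b \<in> W \<Longrightarrow> br a b \<in> W"
    using W by (auto simp: lie_subalgebra_def)
  have fd: "fd_space s V" using V by (simp add: lie_algebra_def)
  interpret vector_space s using fd by (simp add: fd_space_def)
  have mem: "x \<in> V" if "x \<in> W" for x using that sub by blast
  have l: "linear_map s V s V (br a)" "linear_map s V s V (\<lambda>x. br x a)" if "a \<in> W" for a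
    using V mem[OF that] by (auto simp: lie_algebra_def)
  have "linear_map s W s W (br' a)" if a: "a \<in> W" for a
    by (rule linear_mapI)
      (use a in \<open>simp_all add: eq cl subspace_add[OF sub(1)] subspace_scale[OF sub(1)]
        linear_map_add[OF l(1)[OF a]] linear_map_scale[OF l(1)[OF a]] mem\<close>)
  moreover have "linear_map s W s W (\<lambda>x. br' x a)" if a: "a \<in> W" for a
    by (rule linear_mapI)
      (use a in \<open>simp_all add: eq cl subspace_add[OF sub(1)] subspace_scale[OF sub(1)]
        linear_map_add[OF l(2)[OF a]] linear_map_scale[OF l(2)[OF a]] mem\<close>)
  moreover have "br' x x = 0" if "x \<in> W" for x
    using V mem[OF that] that by (auto simp: lie_algebra_def eq)
  moreover have "br' x (br' y z) + br' y (br' z x) + br' z (br' x y) = 0" if "x \<in> W" "y \<in> W" "z \<in> W" for x y z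
    using V mem that by (simp add: lie_algebra_def eq cl)
  ultimately show ?thesis
    using fd_space_subspace[OF fd sub] by (simp add: lie_algebra_def)
qed

text \<open>The star bracket is the twisted double bracket written out, and agrees with it on the
  whole double. For instance, its first \<open>vec_of\<close> term and its terms with
  \<open>t\<close> applied to the coadjoint action of \<open>t \<xi>\<close> or
  \<open>t \<eta>\<close> come from the cyclic sum in \<open>\<phi>t\<close> and from
  \<open>\<omega>t\<close>, after antisymmetry of \<open>\<omega>\<close> and
  \<open>t\<close>.\<close>

lemma (in twist) star_bracket_eq:
  assumes "a \<in> C" "b \<in> C"
  shows "star_bracket s br \<omega> \<phi> t a b = tw.D a b"
proof -
  obtain x \<xi> where a: "a = (x, \<xi>)" by (cases a)
  obtain y \<eta> where b: "b = (y, \<eta>)" by (cases b)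
  have g: "\<xi> \<in> gd" "\<eta> \<in> gd" using assms by (auto simp: a b)
  have lin: "linear_map dscale gd (*) UNIV (\<lambda>\<zeta>. \<xi> (\<omega> (t \<zeta>) \<eta>))"
    using g by (auto intro!: linear_mapI simp: t_add t_scale \<omega>_add \<omega>_scale gd_simps)
  have fst_eq: "f (fst (star_bracket s br \<omega> \<phi> t a b)) = f (fst (tw.D a b))" if f: "f \<in> gd" for f
  proof -
    have e: "\<eta> (br (t f) (t \<xi>)) = - \<eta> (br (t \<xi>) (t f))"
      using br_swap[of "t f" "t \<xi>"] by (simp only: gd_simps(4)[OF g(2)])
    have w: "\<xi> (\<omega> (t \<eta>) f) = - f (\<omega> (t \<eta>) \<xi>)" "\<eta> (\<omega> (t f) \<xi>) = - \<xi> (\<omega> (t f) \<eta>)"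
      using \<omega>_swap g f by blast+
    show ?thesis
      unfolding a b star_bracket_def double_bracket_def split fst_conv gd_simps[OF f] vec_of_apply[OF lin f]
        vec_of_apply[OF \<phi>_linear(3)[OF g] f] vec_of_apply[OF tw.\<phi>_linear(3)[OF g] f]
        t_coad[OF g(1) f] t_coad[OF g(2) f] twist_form_def cyc_def twist_cocycle_def
        gd_simps[OF g(1)] gd_simps[OF g(2)] e w
      by simp
  qed
  have snd_eq: "snd (star_bracket s br \<omega> \<phi> t a b) v = snd (tw.D a b) v" for v
  proof -
    have e: "\<eta> (br v (t \<xi>)) = - \<eta> (br (t \<xi>) v)" "\<xi> (br v (t \<eta>)) = - \<xi> (br (t \<eta>) v)"
      using br_swap[of v "t \<xi>"] br_swap[of v "t \<eta>"]
      by (simp_all only: gd_simps(4)[OF g(1)] gd_simps(4)[OF g(2)])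
    show ?thesis
      by (simp add: a b star_bracket_def double_bracket_def twist_cocycle_def gd_simps(1)[OF g(2)]
          t_coad[OF g] e \<omega>_swap[OF g])
  qed
  show ?thesis
    by (rule prod_eqI) (use separating[OF fst_eq] snd_eq in \<open>auto simp: fun_eq_iff\<close>)
qed

section \<open>Solutions of the dynamical Yang-Baxter equation\<close>

locale dynamical_double = proto_double s br \<omega> \<phi> + dual_open_set s W U
  for s :: "'k::{real_normed_field,euclidean_space} \<Rightarrow> 'g::ab_group_add \<Rightarrow> 'g" and br \<omega> \<phi> W U +
  fixes l :: "('g \<Rightarrow> 'k) \<Rightarrow> ('g \<Rightarrow> 'k) \<Rightarrow> 'g" and q
  assumes br_W: "\<And>x y. x \<in> W \<Longrightarrow> y \<in> W \<Longrightarrow> br x y \<in> W"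
    and l_antisym: "\<And>p. p \<in> U \<Longrightarrow> l p \<in> antisym_maps s"
    and l_smooth: "\<And>\<eta>. \<eta> \<in> gd \<Longrightarrow> smooth (\<lambda>p. l p \<eta>)"
    and quad: "\<And>x \<xi> \<eta> \<zeta>. \<xi> \<in> gd \<Longrightarrow> \<eta> \<in> gd \<Longrightarrow> \<zeta> \<in> gd \<Longrightarrow>
      ad3 br x \<phi> \<xi> \<eta> \<zeta> = cyc (\<lambda>\<xi> \<eta> \<zeta>. \<xi> (\<omega> (\<omega> x \<eta>) \<zeta>)) \<xi> \<eta> \<zeta>"
    and dybe: "\<And>p \<xi> \<eta> \<zeta>. p \<in> U \<Longrightarrow> \<xi> \<in> gd \<Longrightarrow> \<eta> \<in> gd \<Longrightarrow> \<zeta> \<in> gd \<Longrightarrow>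
      cyc (\<lambda>\<xi> \<eta> \<zeta>. \<zeta> (Diff (\<lambda>p. l p \<eta>) p (restr W \<xi>))
             - \<zeta> (br (l p \<xi>) (l p \<eta>)) - \<zeta> (\<omega> (l p \<xi>) \<eta>)) \<xi> \<eta> \<zeta> = \<phi> \<xi> \<eta> \<zeta>"
    and equivariance: "\<And>p z \<eta>. p \<in> U \<Longrightarrow> z \<in> W \<Longrightarrow> \<eta> \<in> gd \<Longrightarrow>
      Diff (\<lambda>p. l p \<eta>) p (coad br W z p) + \<omega> z \<eta> + br z (l p \<eta>) + l p (ad' z \<eta>) = 0"
    and q: "q \<in> U"
begin

sublocale twist s br \<omega> \<phi> "l q"
  by unfold_locales (rule l_antisym[OF q])

abbreviation "dl p v \<eta> \<equiv> Diff (\<lambda>p. l p \<eta>) p v"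

lemma restr_gd: "\<xi> \<in> gd \<Longrightarrow> restr W \<xi> \<in> dual s W"
  by (rule restr_in_dual[OF subspace_W])

lemma q_dual: "q \<in> dual s W"
  using opn.U_subset q by blast

lemma coad_W_in_dual: "z \<in> W \<Longrightarrow> coad br W z q \<in> dual s W"
  using br_W dual_add[OF q_dual] dual_scale[OF q_dual] subspace_add[OF subspace_W] subspace_scale[OF subspace_W]
  by (auto intro!: dualI simp: coad_def restr_def br_add br_scale)

lemma coad_W_apply: "w \<in> W \<Longrightarrow> coad br W z q w = q (br z w)"
  by (simp add: coad_def restr_def)

lemma dl_deriv:
  assumes "p \<in> U" "v \<in> dual s W" "\<eta> \<in> gd" "f \<in> gd"
  shows "((\<lambda>t. f (l (p + dscale t v) \<eta>)) has_field_derivative f (dl p v \<eta>)) (at 0)"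
  using dderiv[OF l_smooth[OF assms(3)] assms(1,2,4)] .

lemma eventually_U: "p \<in> U \<Longrightarrow> v \<in> dual s W \<Longrightarrow> \<forall>\<^sub>F t in nhds 0. p + dscale t v \<in> U"
  by (rule opn.eventually_line)

lemma dl_swap:
  assumes p: "p \<in> U" and v: "v \<in> dual s W" and g: "\<eta> \<in> gd" "\<zeta> \<in> gd"
  shows "\<zeta> (dl p v \<eta>) = - \<eta> (dl p v \<zeta>)"
proof (rule DERIV_unique[OF dl_deriv[OF p v g]])
  have ev: "\<forall>\<^sub>F t in nhds 0. \<zeta> (l (p + dscale t v) \<eta>) = - \<eta> (l (p + dscale t v) \<zeta>)"
    using eventually_U[OF p v] by eventually_elim (rule antisym_mapsD(2)[OF l_antisym g])
  show "((\<lambda>t. \<zeta> (l (p + dscale t v) \<eta>)) has_field_derivative - \<eta> (dl p v \<zeta>)) (at 0)"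
    using DERIV_cong_ev[OF refl ev refl] DERIV_minus[OF dl_deriv[OF p v g(2,1)]] by (rule iffD2)
qed

lemma twist_form_eq_cyc_dl:
  assumes g: "\<xi> \<in> gd" "\<eta> \<in> gd" "\<zeta> \<in> gd"
  shows "\<phi>t \<xi> \<eta> \<zeta> = \<zeta> (dl q (restr W \<xi>) \<eta>) + \<xi> (dl q (restr W \<eta>) \<zeta>) + \<eta> (dl q (restr W \<zeta>) \<xi>)"
  using dybe[OF q g] unfolding twist_form_def cyc_def gd_simps[OF g(1)] gd_simps[OF g(2)] gd_simps[OF g(3)]
  by (simp add: algebra_simps)

text \<open>Companion of \<open>twist_form_eq_cyc_dl\<close>: by equivariance, the twisted cocycle
  on \<open>W\<close> also becomes a differential of \<open>l\<close> at \<open>q\<close>, now along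
  a coadjoint direction.\<close>

lemma twist_cocycle_eq_dl:
  assumes "z \<in> W" "\<eta> \<in> gd"
  shows "\<omega>t z \<eta> = - dl q (coad br W z q) \<eta>"
  using equivariance[OF q assms] by (simp only: twist_cocycle_def eq_neg_iff_add_eq_0 add_ac)

section \<open>Differentials of \<open>l\<close> represented by elements of the subalgebra\<close>

definition moment :: "('g \<Rightarrow> 'k) \<Rightarrow> ('g \<Rightarrow> 'k) \<Rightarrow> 'g"
  where "moment \<xi> \<eta> = (SOME u. u \<in> W \<and> (\<forall>v\<in>dual s W. v u = \<eta> (dl q v \<xi>)))"

text \<open>The differential is linear in its direction \<open>v\<close>, which ranges over the dual
  of \<open>W\<close>, so reflexivity of \<open>W\<close> represents it. Differentiating in a
  direction thus becomes evaluating that direction at an element of \<open>W\<close>.\<close>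

lemma moment:
  assumes "\<xi> \<in> gd" "\<eta> \<in> gd"
  shows "moment \<xi> \<eta> \<in> W" and "v \<in> dual s W \<Longrightarrow> v (moment \<xi> \<eta>) = \<eta> (dl q v \<xi>)"
proof -
  obtain u where "u \<in> W" "\<And>v. v \<in> dual s W \<Longrightarrow> v u = \<eta> (dl q v \<xi>)"
    using bidual_subspace[OF subspace_W linear_map_dderiv[OF l_smooth[OF assms(1)] q assms(2)]] by blast
  then have "\<exists>u. u \<in> W \<and> (\<forall>v\<in>dual s W. v u = \<eta> (dl q v \<xi>))" by blast
  from someI_ex[OF this, folded moment_def]
  show "moment \<xi> \<eta> \<in> W" "v \<in> dual s W \<Longrightarrow> v (moment \<xi> \<eta>) = \<eta> (dl q v \<xi>)" by auto
qed

text \<open>\<open>q\<close> is zero outside \<open>W\<close> and so in general not linear on the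
  whole type. Replacing it by an extension in \<open>gd\<close> allows computing with brackets
  freely.\<close>

lemma extended_point:
  obtains q' where "q' \<in> gd" "\<And>w. w \<in> W \<Longrightarrow> q w = q' w"
proof -
  obtain q' where "q' \<in> gd" "restr W q' = q" using extension[OF subspace_W q_dual] by blast
  then show thesis using that restr_apply by metis
qed

lemma point_br_swap:
  assumes "x \<in> W" "y \<in> W"
  shows "q (br x y) = - q (br y x)"
proof -
  obtain q' where q': "q' \<in> gd" "\<And>w. w \<in> W \<Longrightarrow> q w = q' w" using extended_point by blast
  have "q' (br x y) = - q' (br y x)"
    unfolding br_swap[of x y] by (rule gd_simps(4)[OF q'(1)])
  then show ?thesis
    by (simp only: q'(2)[OF br_W[OF assms]] q'(2)[OF br_W[OF assms(2,1)]])
qed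

section \<open>Second derivatives of \<open>l\<close> and the identity on four covectors\<close>

definition ddl :: "('g \<Rightarrow> 'k) \<Rightarrow> ('g \<Rightarrow> 'k) \<Rightarrow> ('g \<Rightarrow> 'k) \<Rightarrow> ('g \<Rightarrow> 'k) \<Rightarrow> 'k"
  where "ddl \<eta> \<zeta> v w = deriv (\<lambda>t. \<zeta> (dl (q + dscale t w) v \<eta>)) 0"

lemma ddl:
  assumes "\<eta> \<in> gd" "\<zeta> \<in> gd" "v \<in> dual s W" "w \<in> dual s W"
  shows "((\<lambda>t. \<zeta> (dl (q + dscale t w) v \<eta>)) has_field_derivative ddl \<eta> \<zeta> v w) (at 0)"
    and "ddl \<eta> \<zeta> v w = ddl \<eta> \<zeta> w v"
proof -
  obtain S where S: "\<And>v w. v \<in> dual s W \<Longrightarrow> w \<in> dual s W \<Longrightarrow>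
      ((\<lambda>t. \<zeta> (dl (q + dscale t w) v \<eta>)) has_field_derivative S v w) (at 0)"
    "\<And>v w. v \<in> dual s W \<Longrightarrow> w \<in> dual s W \<Longrightarrow> S v w = S w v"
    using second_derivative_exists[OF l_smooth[OF assms(1)] q assms(2)] by blast
  have e: "ddl \<eta> \<zeta> v w = S v w" if "v \<in> dual s W" "w \<in> dual s W" for v w
    unfolding ddl_def by (rule DERIV_imp_deriv[OF S(1)[OF that]])
  show "((\<lambda>t. \<zeta> (dl (q + dscale t w) v \<eta>)) has_field_derivative ddl \<eta> \<zeta> v w) (at 0)"
    unfolding e[OF assms(3,4)] by (rule S(1)[OF assms(3,4)])
  show "ddl \<eta> \<zeta> v w = ddl \<eta> \<zeta> w v"
    unfolding e[OF assms(3,4)] e[OF assms(4,3)] by (rule S(2)[OF assms(3,4)])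
qed

lemma ddl_swap:
  assumes g: "\<eta> \<in> gd" "\<zeta> \<in> gd" and vw: "v \<in> dual s W" "w \<in> dual s W"
  shows "ddl \<eta> \<zeta> v w = - ddl \<zeta> \<eta> v w"
proof (rule DERIV_unique[OF ddl(1)[OF g vw]])
  have ev: "\<forall>\<^sub>F t in nhds 0. \<zeta> (dl (q + dscale t w) v \<eta>) = - \<eta> (dl (q + dscale t w) v \<zeta>)"
    using eventually_U[OF q vw(2)] by eventually_elim (rule dl_swap[OF _ vw(1) g])
  show "((\<lambda>t. \<zeta> (dl (q + dscale t w) v \<eta>)) has_field_derivative - ddl \<zeta> \<eta> v w) (at 0)"
    using DERIV_cong_ev[OF refl ev refl] DERIV_minus[OF ddl(1)[OF g(2,1) vw]] by (rule iffD2)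
qed

text \<open>The Yang-Baxter equation differentiated at \<open>q\<close> in the direction
  \<open>v\<close>. By the product rule each vector such as \<open>dl q v \<xi>\<close> occurs in
  one \<open>\<omega>\<close> term and in two bracket terms from different cyclic summands; together
  these are exactly the twisted cocycle at that vector.\<close>

lemma derivative_dybe:
  assumes g: "\<xi> \<in> gd" "\<eta> \<in> gd" "\<zeta> \<in> gd" and v: "v \<in> dual s W"
  shows "ddl \<eta> \<zeta> (restr W \<xi>) v + ddl \<zeta> \<xi> (restr W \<eta>) v + ddl \<xi> \<eta> (restr W \<zeta>) v =
    \<zeta> (\<omega>t (dl q v \<xi>) \<eta>) + \<xi> (\<omega>t (dl q v \<eta>) \<zeta>) + \<eta> (\<omega>t (dl q v \<zeta>) \<xi>)"
proof (rule DERIV_unique)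
  let ?p = "\<lambda>t. q + dscale t v"
  have p0: "?p 0 = q" by (simp add: fun_eq_iff)
  let ?L = "\<lambda>t. \<zeta> (dl (?p t) (restr W \<xi>) \<eta>) + \<xi> (dl (?p t) (restr W \<eta>) \<zeta>) + \<eta> (dl (?p t) (restr W \<zeta>) \<xi>)"
  show "(?L has_field_derivative
      ddl \<eta> \<zeta> (restr W \<xi>) v + ddl \<zeta> \<xi> (restr W \<eta>) v + ddl \<xi> \<eta> (restr W \<zeta>) v) (at 0)"
    by (intro DERIV_add ddl(1) g restr_gd v)
  let ?R = "\<lambda>t. \<phi> \<xi> \<eta> \<zeta>
      + (\<zeta> (br (l (?p t) \<xi>) (l (?p t) \<eta>)) + \<zeta> (\<omega> (l (?p t) \<xi>) \<eta>))
      + (\<xi> (br (l (?p t) \<eta>) (l (?p t) \<zeta>)) + \<xi> (\<omega> (l (?p t) \<eta>) \<zeta>))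
      + (\<eta> (br (l (?p t) \<zeta>) (l (?p t) \<xi>)) + \<eta> (\<omega> (l (?p t) \<zeta>) \<xi>))"
  \<comment> \<open>The equation is available only at points of \<open>U\<close>, which contains the
    line for small parameters; the derivatives at 0 see no more than that.\<close>
  have ev: "\<forall>\<^sub>F t in nhds 0. ?L t = ?R t"
    using eventually_U[OF q v]
  proof eventually_elim
    case (elim t)
    show ?case using dybe[OF elim g] unfolding cyc_def by (simp add: algebra_simps)
  qed
  have term_deriv: "((\<lambda>t. \<zeta> (br (l (?p t) \<xi>) (l (?p t) \<eta>)) + \<zeta> (\<omega> (l (?p t) \<xi>) \<eta>)) has_field_derivative
      \<zeta> (br (dl q v \<xi>) (l q \<eta>)) + \<zeta> (br (l q \<xi>) (dl q v \<eta>)) + \<zeta> (\<omega> (dl q v \<xi>) \<eta>)) (at 0)"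
    if g: "\<xi> \<in> gd" "\<eta> \<in> gd" "\<zeta> \<in> gd" for \<xi> \<eta> \<zeta>
  proof -
    have m: "(\<lambda>y. \<zeta> (br x y)) \<in> gd" "(\<lambda>x. \<zeta> (br x y)) \<in> gd" for x y
      using g by (auto intro!: dual_UNIV_I simp: br_add br_scale gd_simps)
    have "((\<lambda>t. \<zeta> (br (l (?p t) \<xi>) (l (?p t) \<eta>))) has_field_derivative
        \<zeta> (br (dl q v \<xi>) (l (?p 0) \<eta>)) + \<zeta> (br (l (?p 0) \<xi>) (dl q v \<eta>))) (at 0)"
      by (rule has_field_derivative_bilinear[where \<beta> = "\<lambda>x y. \<zeta> (br x y)" and u = "\<lambda>t. l (?p t) \<xi>"
            and v = "\<lambda>t. l (?p t) \<eta>", OF m dl_deriv[OF q v g(1)] dl_deriv[OF q v g(2)]])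
    from DERIV_add[OF this dl_deriv[OF q v g(1) \<omega>_slice_in_dual[OF g(2,3)]]]
    show ?thesis unfolding p0 .
  qed
  have "(?R has_field_derivative 0
      + (\<zeta> (br (dl q v \<xi>) (l q \<eta>)) + \<zeta> (br (l q \<xi>) (dl q v \<eta>)) + \<zeta> (\<omega> (dl q v \<xi>) \<eta>))
      + (\<xi> (br (dl q v \<eta>) (l q \<zeta>)) + \<xi> (br (l q \<eta>) (dl q v \<zeta>)) + \<xi> (\<omega> (dl q v \<eta>) \<zeta>))
      + (\<eta> (br (dl q v \<zeta>) (l q \<xi>)) + \<eta> (br (l q \<zeta>) (dl q v \<xi>)) + \<eta> (\<omega> (dl q v \<zeta>) \<xi>))) (at 0)"
    by (intro DERIV_add DERIV_const term_deriv g)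
  also have "0
      + (\<zeta> (br (dl q v \<xi>) (l q \<eta>)) + \<zeta> (br (l q \<xi>) (dl q v \<eta>)) + \<zeta> (\<omega> (dl q v \<xi>) \<eta>))
      + (\<xi> (br (dl q v \<eta>) (l q \<zeta>)) + \<xi> (br (l q \<eta>) (dl q v \<zeta>)) + \<xi> (\<omega> (dl q v \<eta>) \<zeta>))
      + (\<eta> (br (dl q v \<zeta>) (l q \<xi>)) + \<eta> (br (l q \<zeta>) (dl q v \<xi>)) + \<eta> (\<omega> (dl q v \<zeta>) \<xi>))
    = \<zeta> (\<omega>t (dl q v \<xi>) \<eta>) + \<xi> (\<omega>t (dl q v \<eta>) \<zeta>) + \<eta> (\<omega>t (dl q v \<zeta>) \<xi>)"
  proof -
    \<comment> \<open>Reversing these brackets puts the differentiated vector first, matching the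
      term \<open>l q\<close> after the coadjoint action in \<open>\<omega>t\<close> as rewritten by
      \<open>t_coad\<close>.\<close>
    have e: "\<zeta> (br (l q \<xi>) (dl q v \<eta>)) = - \<zeta> (br (dl q v \<eta>) (l q \<xi>))"
      "\<xi> (br (l q \<eta>) (dl q v \<zeta>)) = - \<xi> (br (dl q v \<zeta>) (l q \<eta>))"
      "\<eta> (br (l q \<zeta>) (dl q v \<xi>)) = - \<eta> (br (dl q v \<xi>) (l q \<zeta>))"
      using br_swap[of "l q \<xi>" "dl q v \<eta>"] br_swap[of "l q \<eta>" "dl q v \<zeta>"] br_swap[of "l q \<zeta>" "dl q v \<xi>"]
      by (simp_all only: gd_simps(4)[OF g(1)] gd_simps(4)[OF g(2)] gd_simps(4)[OF g(3)])
    show ?thesis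
      unfolding twist_cocycle_def gd_simps(1)[OF g(1)] gd_simps(1)[OF g(2)] gd_simps(1)[OF g(3)] e
        t_coad[OF g(2,3)] t_coad[OF g(3,1)] t_coad[OF g(1,2)]
      by (simp add: algebra_simps)
  qed
  finally show "(?L has_field_derivative
      \<zeta> (\<omega>t (dl q v \<xi>) \<eta>) + \<xi> (\<omega>t (dl q v \<eta>) \<zeta>) + \<eta> (\<omega>t (dl q v \<zeta>) \<xi>)) (at 0)"
    using DERIV_cong_ev[OF refl ev refl] by blast
qed

text \<open>In \<open>form\<close> below, the terms of \<open>\<phi>t\<close> that differentiate in the direction of a bracket of two
  covectors are values of \<open>q\<close> on brackets of two moments (\<open>R\<close>), and cancel in pairs by antisymmetry.
  The remaining terms \<open>X\<close> form the alternation of \<open>derivative_dybe\<close> over four covectors.\<close>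

lemma twisted_jac_covectors_eq_0:
  assumes g: "\<xi> \<in> gd" "\<eta> \<in> gd" "\<zeta> \<in> gd" "\<tau> \<in> gd"
  shows "tw.jac (0, \<xi>) (0, \<eta>) (0, \<zeta>) (0, \<tau>) = 0"
proof -
  define X where "X a b c d = d (\<omega>t (dl q (restr W a) b) c)" for a b c and d :: "'g \<Rightarrow> 'k"
  define R where "R a b c d = q (br (moment a b) (moment c d))" for a b c d
  have X_swap: "X a b c d = - X a b d c" if "c \<in> gd" "d \<in> gd" for a b c d
    unfolding X_def by (rule tw.\<omega>_swap[OF that])
  have form: "double_form (tw.D (0, a) (0, b)) (tw.D (0, c) (0, d)) =
      X a b c d - X b a c d + X c d a b - X d c a b"
    if m: "a \<in> gd" "b \<in> gd" "c \<in> gd" "d \<in> gd" for a b c d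
  proof -
    have P: "\<phi>t a b (\<lambda>v. d (\<omega>t v c)) = X a b c d - X b a c d - R a b c d"
      if m: "a \<in> gd" "b \<in> gd" "c \<in> gd" "d \<in> gd" for a b c d
    proof -
      let ?\<kappa> = "\<lambda>v. d (\<omega>t v c)"
      have \<kappa>: "?\<kappa> \<in> gd" using m(3,4) by (rule tw.\<omega>_slice_in_dual)
      \<comment> \<open>The moment property enters twice: it evaluates \<open>?\<kappa>\<close> at
        an element of \<open>W\<close>, where equivariance applies, and then evaluates the resulting
        coadjoint direction at a second moment.\<close>
      have "b (dl q (restr W ?\<kappa>) a) = restr W ?\<kappa> (moment a b)"
        using moment(2)[OF m(1,2) restr_gd[OF \<kappa>]] by simp
      also have "\<dots> = - d (dl q (coad br W (moment a b) q) c)"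
        using moment(1)[OF m(1,2)] m by (simp add: restr_def twist_cocycle_eq_dl gd_simps(4))
      also have "\<dots> = - R a b c d"
        using moment(2)[OF m(3,4) coad_W_in_dual[OF moment(1)[OF m(1,2)]]] moment(1)[OF m(3,4)]
        by (simp add: coad_W_apply R_def)
      finally show ?thesis
        using twist_form_eq_cyc_dl[OF m(1,2) \<kappa>] dl_swap[OF q restr_gd[OF m(2)] \<kappa> m(1)]
        by (simp add: X_def)
    qed
    let ?u = "vec_of s (\<phi>t c d)"
    have \<kappa>: "(\<lambda>v. d (\<omega>t v c)) \<in> gd" "(\<lambda>v. b (\<omega>t v a)) \<in> gd" using m by blast+
    have Dcd: "tw.D (0, c) (0, d) = (?u, \<lambda>v. d (\<omega>t v c))"
      using m by (simp add: double_bracket_def tw.\<omega>_zero coad_zero)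
    have "b (\<omega>t ?u a) = \<phi>t c d (\<lambda>v. b (\<omega>t v a))"
      using vec_of_apply[OF tw.\<phi>_linear(3)[OF m(3,4)] \<kappa>(2)] .
    moreover have "R a b c d = - R c d a b"
      unfolding R_def by (rule point_br_swap) (use moment(1) m in blast)+
    ultimately show ?thesis
      unfolding Dcd tw.form_bracket[OF m(1,2) \<kappa>(1)] using P[OF m] P[OF m(3,4,1,2)] m
      by (simp add: tw.\<omega>_zero gd_simps(3))
  qed
  have S: "X d a b c + X d b c a + X d c a b = ddl b c (restr W a) (restr W d) + ddl c a (restr W b) (restr W d)
      + ddl a b (restr W c) (restr W d)"
    if m: "a \<in> gd" "b \<in> gd" "c \<in> gd" "d \<in> gd" for a b c d
    using derivative_dybe[OF m(1-3) restr_gd[OF m(4)]] by (simp add: X_def)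
  note r = restr_gd[OF g(1)] restr_gd[OF g(2)] restr_gd[OF g(3)] restr_gd[OF g(4)]
  \<comment> \<open>Alternating yields twelve second derivatives. Three pairs cancel by
    \<open>sym\<close>, between the first sum and the subtracted ones; the other three cancel by
    \<open>alt\<close> among the subtracted sums.\<close>
  have sym: "ddl \<eta> \<zeta> (restr W \<tau>) (restr W \<xi>) = ddl \<eta> \<zeta> (restr W \<xi>) (restr W \<tau>)"
    "ddl \<zeta> \<xi> (restr W \<tau>) (restr W \<eta>) = ddl \<zeta> \<xi> (restr W \<eta>) (restr W \<tau>)"
    "ddl \<xi> \<eta> (restr W \<tau>) (restr W \<zeta>) = ddl \<xi> \<eta> (restr W \<zeta>) (restr W \<tau>)"
    using ddl(2)[OF g(2,3) r(4,1)] ddl(2)[OF g(3,1) r(4,2)] ddl(2)[OF g(1,2) r(4,3)] by simp_all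
  have alt: "ddl \<tau> \<zeta> (restr W \<xi>) (restr W \<eta>) = - ddl \<zeta> \<tau> (restr W \<eta>) (restr W \<xi>)"
    "ddl \<eta> \<tau> (restr W \<xi>) (restr W \<zeta>) = - ddl \<tau> \<eta> (restr W \<zeta>) (restr W \<xi>)"
    "ddl \<tau> \<xi> (restr W \<eta>) (restr W \<zeta>) = - ddl \<xi> \<tau> (restr W \<zeta>) (restr W \<eta>)"
    using ddl(2)[OF g(4,3) r(1,2)] ddl_swap[OF g(4,3) r(2,1)]
      ddl(2)[OF g(2,4) r(1,3)] ddl_swap[OF g(2,4) r(3,1)]
      ddl(2)[OF g(4,1) r(2,3)] ddl_swap[OF g(4,1) r(3,2)] by simp_all
  have "(X \<tau> \<xi> \<eta> \<zeta> + X \<tau> \<eta> \<zeta> \<xi> + X \<tau> \<zeta> \<xi> \<eta>) - (X \<xi> \<tau> \<eta> \<zeta> + X \<xi> \<eta> \<zeta> \<tau> + X \<xi> \<zeta> \<tau> \<eta>)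
      - (X \<eta> \<xi> \<tau> \<zeta> + X \<eta> \<tau> \<zeta> \<xi> + X \<eta> \<zeta> \<xi> \<tau>) - (X \<zeta> \<xi> \<eta> \<tau> + X \<zeta> \<eta> \<tau> \<xi> + X \<zeta> \<tau> \<xi> \<eta>) = 0"
    unfolding S[OF g] S[OF g(4,2,3,1)] S[OF g(1,4,3,2)] S[OF g(1,2,4,3)] sym alt by simp
  moreover have "tw.jac (0, \<xi>) (0, \<eta>) (0, \<zeta>) (0, \<tau>) =
      - ((X \<tau> \<xi> \<eta> \<zeta> + X \<tau> \<eta> \<zeta> \<xi> + X \<tau> \<zeta> \<xi> \<eta>) - (X \<xi> \<tau> \<eta> \<zeta> + X \<xi> \<eta> \<zeta> \<tau> + X \<xi> \<zeta> \<tau> \<eta>)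
      - (X \<eta> \<xi> \<tau> \<zeta> + X \<eta> \<tau> \<zeta> \<xi> + X \<eta> \<zeta> \<xi> \<tau>) - (X \<zeta> \<xi> \<eta> \<tau> + X \<zeta> \<eta> \<tau> \<xi> + X \<zeta> \<tau> \<xi> \<eta>))"
    unfolding tw.jac_def form[OF g] form[OF g(2,3,1,4)] form[OF g(3,1,2,4)]
      X_swap[OF g(4,2), of \<xi> \<zeta>] X_swap[OF g(4,3), of \<eta> \<xi>] X_swap[OF g(4,1), of \<zeta> \<eta>]
    by simp
  ultimately show ?thesis by simp
qed

lemma twisted_double_lie_algebra: "lie_algebra (pscale s dscale) C tw.D"
  by (rule tw.bracket_lie_algebra)
    (rule tw.jac_eq_0[OF twisted_jac_vector_eq_0[OF quad] twisted_jac_covectors_eq_0]; assumption)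

lemma twisted_quasi_bialgebra: "lie_quasi_bialgebra s br \<omega>t \<phi>t"
  unfolding lie_quasi_bialgebra_def
  using lie twist_is_cocycle twist_wedge3 twisted_double_lie_algebra by blast

section \<open>The subspace attached to \<open>q\<close> is a Lagrangian subalgebra\<close>

abbreviation "gs \<equiv> star_carrier s br W q"

lemma star_carrier_iff:
  "(z, \<xi>) \<in> gs \<longleftrightarrow> z \<in> W \<and> \<xi> \<in> gd \<and> (\<forall>w\<in>W. \<xi> w = q (br z w))"
  by (auto simp: star_carrier_def coad_def restr_def fun_eq_iff)

lemma star_carrier_subset: "gs \<subseteq> C"
  by (auto simp: star_carrier_iff)

lemma star_carrier_subspace: "module.subspace (pscale s dscale) gs"
proof -
  interpret p: vector_space "pscale s (dscale :: 'k \<Rightarrow> ('g \<Rightarrow> 'k) \<Rightarrow> _)" by (rule vector_space_pscale)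
  obtain q' where q': "q' \<in> gd" "\<And>w. w \<in> W \<Longrightarrow> q w = q' w" using extended_point by blast
  show ?thesis
  proof (rule p.subspaceI)
    show "0 \<in> gs"
      using q' subspace_0[OF subspace_W] by (simp add: zero_prod_def star_carrier_iff gd_simps(3))
    fix a b c assume "a \<in> gs" "b \<in> gs"
    then show "a + b \<in> gs"
      using q' subspace_add[OF subspace_W] br_W
      by (cases a, cases b) (auto simp: star_carrier_iff br_add gd_simps)
  next
    fix a c assume "a \<in> gs"
    then show "pscale s dscale c a \<in> gs"
      using q' subspace_scale[OF subspace_W] br_W
      by (cases a) (auto simp: star_carrier_iff pscale_def br_scale gd_simps)
  qed
qed

lemma star_carrier_bracket:
  assumes "a \<in> gs" "b \<in> gs"
  shows "tw.D a b \<in> gs"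
proof -
  obtain z \<xi> where a: "a = (z, \<xi>)" by (cases a)
  obtain z' \<xi>' where b: "b = (z', \<xi>')" by (cases b)
  have z: "z \<in> W" "\<xi> \<in> gd" "\<And>w. w \<in> W \<Longrightarrow> \<xi> w = q (br z w)" and rz: "restr W \<xi> = coad br W z q"
    using assms(1) unfolding a star_carrier_iff by (simp_all add: coad_def restr_def fun_eq_iff)
  have z': "z' \<in> W" "\<xi>' \<in> gd" "\<And>w. w \<in> W \<Longrightarrow> \<xi>' w = q (br z' w)" and rz': "restr W \<xi>' = coad br W z' q"
    using assms(2) unfolding b star_carrier_iff by (simp_all add: coad_def restr_def fun_eq_iff)
  let ?m = "moment \<xi> \<xi>'"
  have m: "?m \<in> W" using moment(1) z z' by blast
  \<comment> \<open>On \<open>gs\<close> the restrictions of \<open>\<xi>\<close> and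
    \<open>\<xi>'\<close> are coadjoint directions, so the two terms of \<open>\<phi>t\<close>
    differentiating along them cancel the two \<open>\<omega>t\<close> terms by equivariance. The
    third differentiates along the test covector and gives the moment.\<close>
  have "br z z' + \<omega>t z \<xi>' - \<omega>t z' \<xi> + vec_of s (\<phi>t \<xi> \<xi>') = br z z' + ?m"
  proof (rule separating)
    fix f assume f: "f \<in> gd"
    have "f ?m = \<xi>' (dl q (restr W f) \<xi>)"
      using moment(2)[OF z(2) z'(2) restr_gd[OF f]] m by (simp add: restr_def)
    moreover have "\<xi> (dl q (restr W \<xi>') f) = - f (dl q (restr W \<xi>') \<xi>)"
      by (rule dl_swap[OF q restr_gd[OF z'(2)] f z(2)])
    ultimately show "f (br z z' + \<omega>t z \<xi>' - \<omega>t z' \<xi> + vec_of s (\<phi>t \<xi> \<xi>')) = f (br z z' + ?m)"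
      unfolding gd_simps[OF f] vec_of_apply[OF tw.\<phi>_linear(3)[OF z(2) z'(2)] f]
        twist_form_eq_cyc_dl[OF z(2) z'(2) f] twist_cocycle_eq_dl[OF z(1) z'(2)] twist_cocycle_eq_dl[OF z'(1) z(2)]
      by (simp add: rz rz')
  qed
  then have D: "tw.D a b = (br z z' + ?m, - ad' z \<xi>' + ad' z' \<xi> + (\<lambda>v. \<xi>' (\<omega>t v \<xi>)))"
    by (simp add: a b double_bracket_def)
  have cov: "- ad' z \<xi>' + ad' z' \<xi> + (\<lambda>v. \<xi>' (\<omega>t v \<xi>)) \<in> gd"
    by (intro dual_closed(2,4) coad_in_dual tw.\<omega>_slice_in_dual z z')
  obtain q' where q': "q' \<in> gd" "\<And>w. w \<in> W \<Longrightarrow> q w = q' w" using extended_point by blast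
  \<comment> \<open>On \<open>W\<close> the two coadjoint terms combine to \<open>q\<close> of
    \<open>br (br z z') w\<close> by the Jacobi identity, while the \<open>\<omega>t\<close> term,
    by equivariance, is the contribution of \<open>?m\<close>.\<close>
  have "(- ad' z \<xi>' + ad' z' \<xi> + (\<lambda>v. \<xi>' (\<omega>t v \<xi>))) w = q (br (br z z' + ?m) w)" if w: "w \<in> W" for w
  proof -
    have "\<xi>' (\<omega>t w \<xi>) = - q' (br w ?m)"
      using moment(2)[OF z(2) z'(2) coad_W_in_dual[OF w]] m w q'(2) br_W
      by (simp add: twist_cocycle_eq_dl[OF w z(2)] gd_simps(4)[OF z'(2)] coad_W_apply)
    moreover have "q (br (br z z' + ?m) w) = q' (br z (br z' w)) - q' (br z' (br z w)) - q' (br w ?m)"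
    proof -
      have "br (br z z') w = br z (br z' w) - br z' (br z w)"
        using jacobi[of z z' w] br_swap[of "br z z'" w] br_swap[of w z]
        by (simp add: br_minus algebra_simps add_eq_0_iff)
      moreover have "br (br z z' + ?m) w \<in> W"
        using br_W m w z(1) z'(1) subspace_add[OF subspace_W] by blast
      moreover have "br ?m w = - br w ?m" by (rule br_swap)
      ultimately show ?thesis
        by (simp only: q'(2) br_add(1) gd_simps[OF q'(1)]) simp
    qed
    ultimately show ?thesis
      using z(3) z'(3) br_W w z(1) z'(1) q'(2) by simp
  qed
  then show ?thesis
    unfolding D star_carrier_iff using cov subspace_add[OF subspace_W] br_W z(1) z'(1) m by blast
qed

lemma star_subalgebra: "lie_subalgebra (pscale s dscale) C tw.D gs"
  unfolding lie_subalgebra_def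
  using star_carrier_subspace star_carrier_subset star_carrier_bracket by blast

text \<open>Isotropy is antisymmetry of \<open>q\<close> on brackets. Maximality avoids counting
  dimensions: an element orthogonal to \<open>gs\<close> already belongs to it, because
  \<open>gs\<close> contains enough elements to test both components.\<close>

lemma star_lagrangian: "lagrangian s gs"
proof -
  obtain q' where q': "q' \<in> gd" "\<And>w. w \<in> W \<Longrightarrow> q w = q' w" using extended_point by blast
  have iso: "double_form a b = 0" if "a \<in> gs" "b \<in> gs" for a b
  proof -
    obtain z \<xi> z' \<xi>' where ab: "a = (z, \<xi>)" "b = (z', \<xi>')" by (cases a, cases b) blast
    have "z \<in> W" "z' \<in> W" "\<xi> z' = q (br z z')" "\<xi>' z = q (br z' z)"
      using that by (auto simp: ab star_carrier_iff)
    then show ?thesis using point_br_swap[of z z'] by (simp add: ab form_pair)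
  qed
  have "W' = gs" if W': "isotropic s W'" "gs \<subseteq> W'" for W'
  proof
    show "W' \<subseteq> gs"
    proof
      fix a assume a: "a \<in> W'"
      obtain y \<eta> where a_eq: "a = (y, \<eta>)" by (cases a)
      have \<eta>: "\<eta> \<in> gd" using a W'(1) by (auto simp: isotropic_def a_eq)
      have ort: "\<eta> z + \<xi> y = 0" if "(z, \<xi>) \<in> gs" for z \<xi>
      proof -
        have "double_form a (z, \<xi>) = 0" using a W' that by (auto simp: isotropic_def)
        then show ?thesis by (simp add: a_eq form_pair)
      qed
      have y: "y \<in> W"
      proof (rule ccontr)
        assume "y \<notin> W"
        then obtain f where f: "f \<in> gd" "\<And>w. w \<in> W \<Longrightarrow> f w = 0" "f y = 1"
          using annihilator[OF subspace_W] by blast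
        \<comment> \<open>A covector vanishing on \<open>W\<close> lies in \<open>gs\<close> with
          vector part zero; orthogonality to all of these confines \<open>y\<close> to
          \<open>W\<close>.\<close>
        have "(0, f) \<in> gs"
          using f q' subspace_0[OF subspace_W] by (simp add: star_carrier_iff gd_simps(3))
        then show False using ort f(3) gd_simps(3)[OF \<eta>] by fastforce
      qed
      have "\<eta> w = q (br y w)" if w: "w \<in> W" for w
      proof -
        obtain f where f: "f \<in> gd" "restr W f = coad br W w q"
          using extension[OF subspace_W coad_W_in_dual[OF w]] by blast
        \<comment> \<open>Every \<open>w\<close> in \<open>W\<close> is the vector part of an
          element of \<open>gs\<close>, since its coadjoint direction extends to a covector; pairing
          with this element determines \<open>\<eta> w\<close>.\<close>
        have "(w, f) \<in> gs" using f w by (simp add: star_carrier_def)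
        then have "\<eta> w + q (br w y) = 0" using ort y by (fastforce simp: star_carrier_iff)
        then show ?thesis
          using point_br_swap[OF w y] by simp
      qed
      then show "a \<in> gs" using y \<eta> by (simp add: a_eq star_carrier_iff)
    qed
  qed (fact W')
  then show ?thesis
    unfolding lagrangian_def isotropic_def using star_carrier_subspace star_carrier_subset iso by blast
qed

end

theorem proposition3p3:
  fixes s :: "'k::{real_normed_field,euclidean_space} \<Rightarrow> 'g::ab_group_add \<Rightarrow> 'g"
    and br :: "'g \<Rightarrow> 'g \<Rightarrow> 'g"
    and \<ll> :: "'g set"
    and G :: "'a monoid" and L :: "'a set"
    and T\<^sub>G T\<^sub>L :: "'a topology"
    and A\<^sub>G A\<^sub>L :: "('a set \<times> ('a \<Rightarrow> 'g)) set"
    and c\<^sub>G c\<^sub>L :: "'a set \<times> ('a \<Rightarrow> 'g)"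
    and U :: "('g \<Rightarrow> 'k) set"
    and l :: "('g \<Rightarrow> 'k) \<Rightarrow> ('g \<Rightarrow> 'k) \<Rightarrow> 'g"
    and \<omega> :: "'g \<Rightarrow> ('g \<Rightarrow> 'k) \<Rightarrow> 'g"
    and \<phi> :: "('g \<Rightarrow> 'k) \<Rightarrow> ('g \<Rightarrow> 'k) \<Rightarrow> ('g \<Rightarrow> 'k) \<Rightarrow> 'k"
    and q\<^sub>0 :: "'g \<Rightarrow> 'k"
  assumes lie: "lie_algebra s UNIV br"
    and sub: "lie_subalgebra s UNIV br \<ll>"
    and L: "connected_lie_subgroup s br UNIV G T\<^sub>G A\<^sub>G c\<^sub>G \<ll> L T\<^sub>L A\<^sub>L c\<^sub>L"
    and U_open: "openin (fd_top dscale (dual s \<ll>)) U"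
    and U_inv: "coAd_invariant s \<ll> (G\<lparr>carrier := L\<rparr>) c\<^sub>L U"
    and l_antisym: "\<forall>p\<in>U. l p \<in> antisym_maps s"
    and l_smooth: "\<forall>\<eta>\<in>dual s UNIV. smooth_map dscale (dual s \<ll>) s UNIV U (\<lambda>p. l p \<eta>)"
    and \<omega>: "cocycle s br \<omega>"
    and \<phi>: "\<phi> \<in> wedge3 s"
    and \<phi>_inv: "\<forall>x. \<forall>\<xi>\<in>dual s UNIV. \<forall>\<eta>\<in>dual s UNIV. \<forall>\<zeta>\<in>dual s UNIV.
      ad3 br x \<phi> \<xi> \<eta> \<zeta> = cyc (\<lambda>\<xi> \<eta> \<zeta>. \<xi> (\<omega> (\<omega> x \<eta>) \<zeta>)) \<xi> \<eta> \<zeta>"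
    and dybe: "\<forall>p\<in>U. \<forall>\<xi>\<in>dual s UNIV. \<forall>\<eta>\<in>dual s UNIV. \<forall>\<zeta>\<in>dual s UNIV.
      cyc (\<lambda>\<xi> \<eta> \<zeta>. \<zeta> (dderiv dscale s UNIV (\<lambda>p. l p \<eta>) p (restr \<ll> \<xi>))
             - \<zeta> (br (l p \<xi>) (l p \<eta>)) - \<zeta> (\<omega> (l p \<xi>) \<eta>)) \<xi> \<eta> \<zeta> = \<phi> \<xi> \<eta> \<zeta>"
    and equivariance: "\<forall>p\<in>U. \<forall>z\<in>\<ll>. \<forall>\<eta>\<in>dual s UNIV.
      dderiv dscale s UNIV (\<lambda>p. l p \<eta>) p (coad br \<ll> z p)
        + \<omega> z \<eta> + br z (l p \<eta>) + l p (coad br UNIV z \<eta>) = 0"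
    and q\<^sub>0: "q\<^sub>0 \<in> U"
  defines "\<omega>' \<equiv> twist_cocycle br (l q\<^sub>0) \<omega>"
    and "\<phi>' \<equiv> twist_form br (l q\<^sub>0) \<omega> \<phi>"
    and "\<gg>\<^sub>s \<equiv> star_carrier s br \<ll> q\<^sub>0"
    and "br\<^sub>s \<equiv> star_bracket s br \<omega> \<phi> (l q\<^sub>0)"
  shows "lie_quasi_bialgebra s br \<omega>' \<phi>'
    \<and> lie_algebra (pscale s dscale) \<gg>\<^sub>s br\<^sub>s
    \<and> lie_subalgebra (pscale s dscale) (double_carrier s) (double_bracket s br \<omega>' \<phi>') \<gg>\<^sub>s
    \<and> (\<forall>a\<in>\<gg>\<^sub>s. \<forall>b\<in>\<gg>\<^sub>s. br\<^sub>s a b = double_bracket s br \<omega>' \<phi>' a b)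
    \<and> lagrangian s \<gg>\<^sub>s"
proof -
  interpret dynamical_double s br \<omega> \<phi> \<ll> U l q\<^sub>0
  proof
    show "fd_space s UNIV" using lie by (simp add: lie_algebra_def)
    show "module.subspace s \<ll>" "\<And>x y. x \<in> \<ll> \<Longrightarrow> y \<in> \<ll> \<Longrightarrow> br x y \<in> \<ll>"
      using sub by (simp_all add: lie_subalgebra_def)
  qed (use assms in simp_all)
  have star: "br\<^sub>s a b = double_bracket s br \<omega>' \<phi>' a b" if "a \<in> \<gg>\<^sub>s" "b \<in> \<gg>\<^sub>s" for a b
    using star_bracket_eq[of a b] star_carrier_subset that
    unfolding \<omega>'_def \<phi>'_def \<gg>\<^sub>s_def br\<^sub>s_def by blast
  moreover have "lie_algebra (pscale s dscale) \<gg>\<^sub>s br\<^sub>s"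
    using lie_algebra_restrict[OF twisted_double_lie_algebra star_subalgebra] star
    unfolding \<omega>'_def \<phi>'_def \<gg>\<^sub>s_def by blast
  ultimately show ?thesis
    using twisted_quasi_bialgebra star_subalgebra star_lagrangian
    unfolding \<omega>'_def \<phi>'_def \<gg>\<^sub>s_def by blast
qed

end
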